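(* Let $m\ge 1$, let $\beta=(\beta_n)_{n\in\mathbb N^m}$ be a multi-sequence of positive numbers, and suppose the multiplication $m$-tuple $M_z=(M_{z_1},\dots,M_{z_m})$ on $H^2(\beta)$ is bounded. Then $M_z$ is spherical if and only if there is a sequence $b_0,b_1,b_2,\dots$ of positive numbers such that $$\|f\|_\beta^2=\sum_{k=0}^\infty b_k^2\,\|f_{[k]}\|^2_{L^2(\partial\mathbb B,\sigma)}\qquad (f\in H^2(\beta)).$$ If this happens, then $M_z$ is unitarily equivalent to the $m$-variable weighted shift with weights $$w^{(i)}_n=\frac{b_{|n|+1}}{b_{|n|}}\sqrt{\frac{n_i+1}{|n|+m}}\qquad(n\in\mathbb N^m,\ 1\le i\le m),$$ and $\beta_n=\|z^n\|_\beta$ is given by $$\beta_n=b_{|n|}\sqrt{\frac{(m-1)!\,n!}{(m-1+|n|)!}}\qquad(n\in\mathbb N^m).$$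
   Context: $\mathbb N=\{0,1,2,\dots\}$. For $n=(n_1,\dots,n_m)\in\mathbb N^m$: $|n|=n_1+\dots+n_m$, $n!=n_1!\cdots n_m!$, $z^n=z_1^{n_1}\cdots z_m^{n_m}$, and $\epsilon_j$ is the multi-index with $1$ in the $j$-th place and $0$ elsewhere. For a multi-sequence $\beta$ of positive numbers, $H^2(\beta)$ is the Hilbert space of formal power series $f(z)=\sum_{n\in\mathbb N^m}a_nz^n$ with $\|f\|_\beta^2=\sum_n|a_n|^2\beta_n^2<\infty$; $M_{z_j}$ is multiplication by $z_j$. For such $f$, $f_{[k]}=\sum_{|n|=k}a_nz^n$ is its homogeneous part of degree $k$. $\sigma$ is the normalized surface area measure on the unit sphere $\partial\mathbb B=\{z\in\mathbb C^m:|z_1|^2+\dots+|z_m|^2=1\}$. For $U=(u_{jk})$ in the unitary group $\mathcal U(m)$ and a commuting operator $m$-tuple $T=(T_1,\dots,T_m)$, $T_U$ is the $m$-tuple with $(T_U)_j=\sum_k u_{jk}T_k$. A commuting $m$-tuple $T$ of bounded operators on an infinite-dimensional Hilbert space $\mathcal H$ is spherical if for every $U\in\mathcal U(m)$ there is a unitary $\Gamma(U)$ on $\mathcal H$ with $\Gamma(U)T_j=(T_U)_j\Gamma(U)$ for all $j$. An $m$-variable weighted shift with positive weights $\{w^{(j)}_n\}$ with respect to an orthonormal basis $\{e_n\}_{n\in\mathbb N^m}$ is the commuting tuple defined by $T_je_n=w^{(j)}_ne_{n+\epsilon_j}$. *)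

theory Defs
  imports "HOL-Analysis.Analysis"
begin

text \<open>Multi-indices in N^m are functions 'm \<Rightarrow> nat for a finite nonempty index type 'm
  (so m = CARD('m) \<ge> 1). Formal power series are coefficient functions.\<close>

type_synonym 'm mi = "'m \<Rightarrow> nat"
type_synonym 'm series = "'m mi \<Rightarrow> complex"

definition mi_abs :: "'m::finite mi \<Rightarrow> nat" where
  "mi_abs n = (\<Sum>i\<in>UNIV. n i)"

definition mi_fact :: "'m::finite mi \<Rightarrow> nat" where
  "mi_fact n = (\<Prod>i\<in>UNIV. fact (n i))"

definition H2 :: "('m mi \<Rightarrow> real) \<Rightarrow> 'm series set" where
  "H2 \<beta> = {a. (\<lambda>n. (cmod (a n))\<^sup>2 * (\<beta> n)\<^sup>2) summable_on UNIV}"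

definition H2_normsq :: "('m mi \<Rightarrow> real) \<Rightarrow> 'm series \<Rightarrow> real" where
  "H2_normsq \<beta> a = (\<Sum>\<^sub>\<infinity>n. (cmod (a n))\<^sup>2 * (\<beta> n)\<^sup>2)"

definition H2_norm :: "('m mi \<Rightarrow> real) \<Rightarrow> 'm series \<Rightarrow> real" where
  "H2_norm \<beta> a = sqrt (H2_normsq \<beta> a)"

definition Mz :: "'m \<Rightarrow> 'm series \<Rightarrow> 'm series" where
  "Mz j a = (\<lambda>n. if n j = 0 then 0 else a (n(j := n j - 1)))"

definition Mz_bounded :: "('m mi \<Rightarrow> real) \<Rightarrow> bool" where
  "Mz_bounded \<beta> \<longleftrightarrow> (\<forall>j. \<exists>C. \<forall>a\<in>H2 \<beta>. Mz j a \<in> H2 \<beta> \<and> H2_norm \<beta> (Mz j a) \<le> C * H2_norm \<beta> a)"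

definition unitary_map ::
  "('a \<Rightarrow> complex) set \<Rightarrow> (('a \<Rightarrow> complex) \<Rightarrow> real) \<Rightarrow> ('b \<Rightarrow> complex) set \<Rightarrow> (('b \<Rightarrow> complex) \<Rightarrow> real)
    \<Rightarrow> (('a \<Rightarrow> complex) \<Rightarrow> ('b \<Rightarrow> complex)) \<Rightarrow> bool" where
  "unitary_map H nH K nK V \<longleftrightarrow>
     bij_betw V H K \<and>
     (\<forall>a\<in>H. \<forall>b\<in>H. V (\<lambda>n. a n + b n) = (\<lambda>n. V a n + V b n)) \<and>
     (\<forall>c. \<forall>a\<in>H. V (\<lambda>n. c * a n) = (\<lambda>n. c * V a n)) \<and>
     (\<forall>a\<in>H. nK (V a) = nH a)"

definition unitary_matrix :: "complex^'m^'m \<Rightarrow> bool" where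
  "unitary_matrix U \<longleftrightarrow>
     (\<chi> i j. cnj (U $ j $ i)) ** U = mat 1 \<and> U ** (\<chi> i j. cnj (U $ j $ i)) = mat 1"

definition Mz_spherical :: "('m::finite mi \<Rightarrow> real) \<Rightarrow> bool" where
  "Mz_spherical \<beta> \<longleftrightarrow>
     (\<forall>U::complex^'m^'m. unitary_matrix U \<longrightarrow>
        (\<exists>\<Gamma>. unitary_map (H2 \<beta>) (H2_norm \<beta>) (H2 \<beta>) (H2_norm \<beta>) \<Gamma> \<and>
              (\<forall>j. \<forall>a\<in>H2 \<beta>. \<Gamma> (Mz j a) = (\<lambda>n. \<Sum>k\<in>UNIV. U $ j $ k * Mz k (\<Gamma> a) n))))"

text \<open>Normalized surface measure on the unit sphere of C^m, defined as the cone measure: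
  the image of normalized Lebesgue measure on the unit ball under x \<mapsto> x/|x|.\<close>
definition sphere_measure :: "(complex^'m::finite) measure" where
  "sphere_measure = distr (uniform_measure lborel (ball 0 1)) borel (\<lambda>x. x /\<^sub>R norm x)"

definition hom_part :: "'m::finite series \<Rightarrow> nat \<Rightarrow> complex^'m \<Rightarrow> complex" where
  "hom_part a k z = (\<Sum>n\<in>{n. mi_abs n = k}. a n * (\<Prod>i\<in>UNIV. (z $ i) ^ (n i)))"

definition hom_L2_normsq :: "'m::finite series \<Rightarrow> nat \<Rightarrow> real" where
  "hom_L2_normsq a k = integral\<^sup>L sphere_measure (\<lambda>z. (cmod (hom_part a k z))\<^sup>2)"

text \<open>The model Hilbert space l^2(N^m) with orthonormal basis e_n (indicator of n),
  and the m-variable weighted shift T_j e_n = w_j(n) e_{n+e_j}.\<close>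
definition l2 :: "'m series set" where
  "l2 = {x. (\<lambda>n. (cmod (x n))\<^sup>2) summable_on UNIV}"

definition l2_norm :: "'m series \<Rightarrow> real" where
  "l2_norm x = sqrt (\<Sum>\<^sub>\<infinity>n. (cmod (x n))\<^sup>2)"

definition wshift :: "('m \<Rightarrow> 'm mi \<Rightarrow> real) \<Rightarrow> 'm \<Rightarrow> 'm series \<Rightarrow> 'm series" where
  "wshift w j x = (\<lambda>n. if n j = 0 then 0
                        else complex_of_real (w j (n(j := n j - 1))) * x (n(j := n j - 1)))"

end

theory Submission
  imports Defs "HOL-Probability.Probability_Measure"
begin

text \<open>
  Both the surface measure \<open>\<sigma>\<close> and a spherical \<open>\<beta>\<close> give weights \<open>w\<close> for which \<open>f \<mapsto> f \<circ> U\<close> is isometric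
  on homogeneous polynomials of degree \<open>K\<close>, namely \<open>w n = \<integral>|z^n|\<^sup>2 d\<sigma>\<close> and \<open>w n = (\<beta> n)\<^sup>2\<close>. In the
  spherical case this holds because the intertwining unitary maps the orthogonal complement of the
  ranges of the \<open>M_z\<close>, the constants, onto itself and so acts on polynomials as a unimodular
  multiple of \<open>f \<mapsto> f \<circ> U\<close>.

  Any such weight is a multiple of \<open>n!\<close> on each degree: being unitary, composition with \<open>U\<close> has
  composition with \<open>U*\<close> as its adjoint, so comparing the coefficient \<open>(K!/l!) u^l\<close> of \<open>z^l\<close> in
  \<open>(U z)_i^K\<close> with the coefficient \<open>conj (u^l)\<close> of \<open>z_i^K\<close> in \<open>(U* z)^l\<close>, where \<open>u\<close> is the \<open>i\<close>-th row
  of \<open>U\<close>, gives \<open>w l = (l!/K!) w (K e_i)\<close> as soon as \<open>u\<close> has no zero entry. Hence \<open>(\<beta> n)\<^sup>2\<close> is a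
  multiple, depending on \<open>|n|\<close> only, of \<open>\<integral>|z^n|\<^sup>2 d\<sigma>\<close>, and the latter is computed from the recursion
  expressing that \<open>|z_1|\<^sup>2 + \<dots> + |z_m|\<^sup>2 = 1\<close> on the sphere. Conversely, if the norm is given by \<open>\<sigma>\<close>,
  then \<open>f \<mapsto> f \<circ> U\<close> is the required unitary.
\<close>

section \<open>Unitary invariance of the surface measure\<close>

lemma orthogonal_transformation_borel_measurable:
  fixes f :: "'a::euclidean_space \<Rightarrow> 'a"
  assumes "orthogonal_transformation f"
  shows "f \<in> borel_measurable borel"
  using assms
  by (intro borel_measurable_continuous_onI linear_continuous_on)
    (simp add: orthogonal_transformation linear_conv_bounded_linear)


text \<open>
  The image measure is translation invariant as well, and two translation invariant measures are
  proportional by Fubini: \<open>\<mu>(B) \<lambda>(S) = \<mu>(S) \<lambda>(B)\<close> with \<open>B\<close> the unit ball, which has the same measure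
  under both.
\<close>
lemma lborel_distr_orthogonal_transformation:
  fixes f :: "'a::euclidean_space \<Rightarrow> 'a"
  assumes f: "orthogonal_transformation f"
  shows "distr lborel borel f = lborel"
proof (rule measure_eqI)
  show "sets (distr lborel borel f) = sets lborel" by simp
next
  have lin: "linear f" and nrm: "\<And>v. norm (f v) = norm v"
    using f by (auto simp: orthogonal_transformation)
  have [measurable]: "f \<in> borel_measurable borel"
    by (rule orthogonal_transformation_borel_measurable[OF f])
  let ?M = "distr lborel borel f"
  let ?B = "ball 0 1 :: 'a set"
  have shift: "distr ?M borel ((+) c) = ?M" for c
  proof -
    obtain d where d: "c = f d"
      using orthogonal_transformation_surj[OF f] by (meson surjD)
    have "(+) c \<circ> f = f \<circ> (+) d"
      using linear_add[OF lin] by (auto simp: d)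
    then have "distr ?M borel ((+) c) = distr (distr lborel borel ((+) d)) borel f"
      by (subst (1 2) distr_distr) (auto simp: comp_def)
    then show ?thesis by (simp add: lborel_distr_plus)
  qed
  have fB: "emeasure ?M ?B = emeasure lborel ?B"
  proof -
    have "f -` ?B = ?B" by (auto simp: nrm)
    then show ?thesis by (subst emeasure_distr) auto
  qed
  have Bfin: "emeasure lborel ?B \<noteq> \<infinity>" "emeasure lborel ?B \<noteq> 0"
    using emeasure_lborel_ball_finite[of 0 1] content_ball_pos[of 1 "0::'a"] 
    by (auto simp: less_top measure_def)
  have ballc: "emeasure lborel (ball x 1) = emeasure lborel ?B" for x :: 'a
  proof -
    have "emeasure lborel (ball x 1) = emeasure (distr lborel borel ((+) x)) (ball x 1)"
      by (simp add: lborel_distr_plus)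
    also have "\<dots> = emeasure lborel ?B"
      by (subst emeasure_distr) (auto intro!: arg_cong[where f = "emeasure lborel"] simp: dist_norm)
    finally show ?thesis .
  qed
  \<comment> \<open>Required for Fubini. As \<open>f\<close> preserves norms, centred balls keep
    their finite Lebesgue measure under the image measure.\<close>
  interpret M: sigma_finite_measure ?M
  proof
    let ?A = "range (\<lambda>n::nat. ball (0::'a) (real n))"
    show "\<exists>A. countable A \<and> A \<subseteq> sets ?M \<and> \<Union> A = space ?M \<and> (\<forall>a\<in>A. emeasure ?M a \<noteq> \<infinity>)"
    proof (intro exI[of _ ?A] conjI ballI)
      show "\<Union> ?A = space ?M"
        by (auto simp: reals_Archimedean2)
      fix a assume "a \<in> ?A"
      then obtain n :: nat where a: "a = ball 0 (real n)" by auto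
      have "f -` a = a" by (auto simp: nrm a)
      then have "emeasure ?M a = emeasure lborel a"
        by (subst emeasure_distr) (auto simp: a)
      then show "emeasure ?M a \<noteq> \<infinity>"
        using emeasure_lborel_ball_finite[of "0::'a" "real n"] by (auto simp: a less_top)
    qed auto
  qed
  interpret P: pair_sigma_finite lborel ?M ..
  fix S assume "S \<in> sets ?M"
  then have S[measurable]: "S \<in> sets borel" by simp
  have ind: "(\<lambda>p. indicator T (g p) :: ennreal) \<in> borel_measurable (lborel \<Otimes>\<^sub>M ?M)"
    if "T \<in> sets borel" "continuous_on UNIV g" for T :: "'a set" and g :: "'a \<times> 'a \<Rightarrow> 'a"
  proof -
    have s: "sets (lborel \<Otimes>\<^sub>M ?M) = sets (borel :: ('a \<times> 'a) measure)"
      unfolding borel_prod[symmetric] by (rule sets_pair_measure_cong) auto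
    have "g \<in> borel_measurable (lborel \<Otimes>\<^sub>M ?M)"
      unfolding measurable_cong_sets[OF s refl] by (rule borel_measurable_continuous_onI[OF that(2)])
    then show ?thesis
      by (rule measurable_compose) (use that in \<open>auto intro: borel_measurable_indicator\<close>)
  qed
  \<comment> \<open>The integral of 1_B(x) 1_S(x+y) is computed in both orders. Integrating over
    \<open>y\<close> first uses translation invariance of \<open>lborel\<close>. Integrating over
    \<open>x\<close> first, the substitution x \<rightarrow> x - y uses \<open>shift\<close>, and
    after swapping back the inner integral is the measure of a unit ball around
    \<open>x\<close>.\<close>
  have "emeasure ?M ?B * emeasure lborel S
      = (\<integral>\<^sup>+x. indicator ?B x * (\<integral>\<^sup>+y. indicator S y \<partial>lborel) \<partial>?M)"
    by (subst nn_integral_multc) (auto intro!: borel_measurable_indicator)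
  also have "\<dots> = (\<integral>\<^sup>+x. indicator ?B x * (\<integral>\<^sup>+y. indicator S (x + y) \<partial>lborel) \<partial>?M)"
  proof -
    have "(\<integral>\<^sup>+y. indicator S y \<partial>lborel) = (\<integral>\<^sup>+y. indicator S (x + y) \<partial>lborel)" for x
      by (subst (1) lborel_distr_plus[symmetric, of x], subst nn_integral_distr) auto
    then show ?thesis by simp
  qed
  also have "\<dots> = (\<integral>\<^sup>+x. (\<integral>\<^sup>+y. indicator ?B x * indicator S (x + y) \<partial>lborel) \<partial>?M)"
    by (simp add: nn_integral_cmult)
  also have "\<dots> = (\<integral>\<^sup>+y. (\<integral>\<^sup>+x. indicator ?B x * indicator S (x + y) \<partial>?M) \<partial>lborel)"
    by (rule P.Fubini', unfold case_prod_unfold, intro borel_measurable_times_ennreal ind) (auto intro!: continuous_intros)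
  also have "\<dots> = (\<integral>\<^sup>+y. (\<integral>\<^sup>+x. indicator ?B (x - y) * indicator S x \<partial>?M) \<partial>lborel)"
  proof (rule nn_integral_cong)
    fix y
    have m: "(\<lambda>x. indicator ?B (x - y) * indicator S x :: ennreal) \<in> borel_measurable borel"
      by (intro borel_measurable_times_ennreal measurable_compose[of "\<lambda>x. x - y" borel borel "indicator ?B"]
          borel_measurable_indicator) auto
    have "(\<integral>\<^sup>+x. indicator ?B (x - y) * indicator S x \<partial>?M)
        = (\<integral>\<^sup>+x. indicator ?B (x - y) * indicator S x \<partial>(distr ?M borel ((+) y)))"
      by (simp only: shift)
    also have "\<dots> = (\<integral>\<^sup>+x. indicator ?B (y + x - y) * indicator S (y + x) \<partial>?M)"
      by (rule nn_integral_distr) (use m in simp_all)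
    finally show "(\<integral>\<^sup>+x. indicator ?B x * indicator S (x + y) \<partial>?M)
        = (\<integral>\<^sup>+x. indicator ?B (x - y) * indicator S x \<partial>?M)"
      by (simp add: add.commute)
  qed
  also have "\<dots> = (\<integral>\<^sup>+x. (\<integral>\<^sup>+y. indicator ?B (x - y) * indicator S x \<partial>lborel) \<partial>?M)"
    by (rule P.Fubini'[symmetric], unfold case_prod_unfold, intro borel_measurable_times_ennreal ind) (auto intro!: continuous_intros)
  also have "\<dots> = (\<integral>\<^sup>+x. emeasure lborel ?B * indicator S x \<partial>?M)"
  proof (rule nn_integral_cong)
    fix x
    have "(\<integral>\<^sup>+y. indicator ?B (x - y) * indicator S x \<partial>lborel) = (\<integral>\<^sup>+y. indicator (ball x 1) y * indicator S x \<partial>lborel)"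
      by (rule nn_integral_cong) (auto simp: indicator_def dist_norm norm_minus_commute)
    also have "\<dots> = (\<integral>\<^sup>+y. indicator (ball x 1) y \<partial>lborel) * indicator S x"
      by (rule nn_integral_multc) (auto intro!: borel_measurable_indicator)
    finally show "(\<integral>\<^sup>+y. indicator ?B (x - y) * indicator S x \<partial>lborel) = emeasure lborel ?B * indicator S x"
      by (simp add: ballc[of x])
  qed
  also have "\<dots> = emeasure lborel ?B * emeasure ?M S"
    by (simp add: nn_integral_cmult)
  finally show "emeasure ?M S = emeasure lborel S"
    using Bfin by (simp add: fB ennreal_mult_cancel_left)
qed

section \<open>Unitary matrices as isometries, and their action on the sphere\<close>

lemma unitary_matrix_columns:
  assumes "unitary_matrix U"
  shows "(\<Sum>i\<in>UNIV. cnj (U $ i $ k) * U $ i $ l) = (if k = l then 1 else 0)"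
proof -
  have "((\<chi> i j. cnj (U $ j $ i)) ** U) $ k $ l = mat 1 $ k $ l"
    using assms by (simp add: unitary_matrix_def)
  then show ?thesis by (simp add: matrix_matrix_mult_def mat_def)
qed

text \<open>Regards the unitary as a real isometry, so that the result on Lebesgue measure applies.
  In the expanded squared norm, the sum over rows collapses by orthonormality of the
  columns.\<close>

lemma orthogonal_transformation_unitary:
  assumes U: "unitary_matrix (U :: complex^'m^'m)"
  shows "orthogonal_transformation (\<lambda>z. U *v z)"
  unfolding orthogonal_transformation
proof safe
  show "linear ((*v) U)"
    by (auto intro!: linearI simp: matrix_vector_right_distrib vec_eq_iff matrix_vector_mult_def scaleR_sum_right)
  fix z :: "complex^'m"
  have orth: "(\<Sum>i\<in>UNIV. U$i$j * cnj (U$i$k)) = (if j = k then 1 else 0)" for j k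
    using unitary_matrix_columns[OF U, of k j] by (simp add: mult.commute eq_commute)
  have cn: "complex_of_real ((norm x)\<^sup>2) = (\<Sum>i\<in>UNIV. x$i * cnj (x$i))" for x :: "complex^'m"
    by (simp add: norm_vec_def L2_set_def sum_nonneg flip: complex_norm_square)
  have "complex_of_real ((norm (U *v z))\<^sup>2) = (\<Sum>i\<in>UNIV. (\<Sum>j\<in>UNIV. U$i$j * z$j) * (\<Sum>k\<in>UNIV. cnj (U$i$k) * cnj (z$k)))"
    unfolding cn by (simp add: matrix_vector_mult_def)
  also have "\<dots> = (\<Sum>i\<in>UNIV. \<Sum>j\<in>UNIV. \<Sum>k\<in>UNIV. z$j * cnj (z$k) * (U$i$j * cnj (U$i$k)))"
    by (simp add: sum_product mult_ac)
  also have "\<dots> = (\<Sum>j\<in>UNIV. \<Sum>k\<in>UNIV. \<Sum>i\<in>UNIV. z$j * cnj (z$k) * (U$i$j * cnj (U$i$k)))"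
    by (rule trans[OF sum.swap], rule sum.cong[OF refl], rule sum.swap)
  also have "\<dots> = (\<Sum>j\<in>UNIV. z$j * cnj (z$j))"
    by (simp add: sum_distrib_left[symmetric] orth if_distrib cong: if_cong)
  also have "\<dots> = complex_of_real ((norm z)\<^sup>2)"
    unfolding cn ..
  finally have "(norm (U *v z))\<^sup>2 = (norm z)\<^sup>2"
    using of_real_eq_iff by blast
  then show "norm (U *v z) = norm z" by simp
qed

lemma prob_space_ball: "prob_space (uniform_measure lborel (ball (0::'a::euclidean_space) 1))"
proof (rule prob_space_uniform_measure)
  show "emeasure lborel (ball (0::'a) 1) \<noteq> 0"
    using content_ball_pos[of 1 "0::'a"] by (auto simp: measure_def)
  show "emeasure lborel (ball (0::'a) 1) \<noteq> \<infinity>"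
    using emeasure_lborel_ball_finite[of "0::'a" 1] by auto
qed

lemma prob_space_sphere_measure: "prob_space (sphere_measure :: (complex^'m::finite) measure)"
  unfolding sphere_measure_def
  by (rule prob_space.prob_space_distr[OF prob_space_ball]) simp

lemma sets_sphere_measure [measurable_cong, simp]: "sets sphere_measure = sets borel"
  by (simp add: sphere_measure_def)

lemma uniform_ball_orthogonal_transformation:
  fixes f :: "'a::euclidean_space \<Rightarrow> 'a"
  assumes f: "orthogonal_transformation f"
  shows "distr (uniform_measure lborel (ball 0 1)) borel f = uniform_measure lborel (ball 0 1)"
proof (rule measure_eqI)
  have lin: "linear f" and nrm: "\<And>v. norm (f v) = norm v"
    using f by (auto simp: orthogonal_transformation)
  have [measurable]: "f \<in> borel_measurable borel"
    by (rule orthogonal_transformation_borel_measurable[OF f])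
  fix S assume "S \<in> sets (distr (uniform_measure lborel (ball 0 1)) borel f)"
  then have [measurable]: "S \<in> sets borel" by simp
  have "emeasure lborel (ball 0 1 \<inter> f -` S) = emeasure (distr lborel borel f) (ball 0 1 \<inter> S)"
    by (subst emeasure_distr) (auto intro!: arg_cong[where f = "emeasure lborel"] simp: nrm)
  moreover have "f -` S \<in> sets borel"
    by (rule measurable_sets_borel[of f borel]) auto
  ultimately show "emeasure (distr (uniform_measure lborel (ball 0 1)) borel f) S
      = emeasure (uniform_measure lborel (ball 0 1)) S"
    by (simp add: emeasure_distr lborel_distr_orthogonal_transformation[OF f])
qed simp

text \<open>A linear isometry commutes with the radial projection \<open>?s\<close>, so invariance
  of the uniform measure on the ball passes to its image on the sphere.\<close>

lemma distr_sphere_measure_unitary: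
  fixes U :: "complex^'m^'m"
  assumes U: "unitary_matrix U"
  shows "distr sphere_measure borel (\<lambda>z. U *v z) = sphere_measure"
proof -
  let ?f = "\<lambda>z. U *v z"
  let ?s = "\<lambda>x::complex^'m. x /\<^sub>R norm x"
  have ot: "orthogonal_transformation ?f" by (rule orthogonal_transformation_unitary[OF U])
  then have lin: "linear ?f" and nrm: "\<And>v. norm (?f v) = norm v"
    by (auto simp: orthogonal_transformation)
  have [measurable]: "?f \<in> borel_measurable borel"
    by (rule orthogonal_transformation_borel_measurable[OF ot])
  have "?f \<circ> ?s = ?s \<circ> ?f"
    by (auto simp: linear_scale[OF lin] nrm)
  then have "distr sphere_measure borel ?f
      = distr (distr (uniform_measure lborel (ball 0 1)) borel ?f) borel ?s"
    unfolding sphere_measure_def by (subst (1 2) distr_distr) (auto simp: comp_def)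
  then show ?thesis
    by (simp add: uniform_ball_orthogonal_transformation[OF ot] sphere_measure_def)
qed

section \<open>Monomials on the sphere\<close>

definition mi_pow :: "complex^'m::finite \<Rightarrow> 'm mi \<Rightarrow> complex" where
  "mi_pow z n = (\<Prod>i\<in>UNIV. (z $ i) ^ n i)"

lemma hom_part_eq: "hom_part a k z = (\<Sum>n | mi_abs n = k. a n * mi_pow z n)"
  by (simp add: hom_part_def mi_pow_def)

lemma finite_mi_abs: "finite {n::'m::finite mi. mi_abs n = k}"
proof (rule finite_subset)
  show "{n::'m mi. mi_abs n = k} \<subseteq> PiE UNIV (\<lambda>_. {..k})"
    by (auto simp: mi_abs_def PiE_UNIV_domain intro: member_le_sum)
qed (auto intro: finite_PiE)

lemma mi_abs_Suc: "mi_abs (n(j := Suc (n j))) = Suc (mi_abs n)" for n :: "'m::finite mi"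
  by (simp add: mi_abs_def sum.remove[of UNIV j])

lemma mi_fact_Suc: "mi_fact (n(j := Suc (n j))) = Suc (n j) * mi_fact n" for n :: "'m::finite mi"
  by (simp add: mi_fact_def prod.remove[of UNIV j] algebra_simps)

lemma mi_pow_Suc: "mi_pow z (n(j := Suc (n j))) = z $ j * mi_pow z n"
  by (simp add: mi_pow_def prod.remove[of UNIV j] algebra_simps)

lemma mi_dec_eq: "n j \<noteq> 0 \<Longrightarrow> (n(j := n j - 1))(j := Suc ((n(j := n j - 1)) j)) = (n::'m mi)"
  by auto

lemma mi_abs_dec: "n j \<noteq> 0 \<Longrightarrow> mi_abs n = Suc (mi_abs (n(j := n j - 1)))" for n :: "'m::finite mi"
  by (metis mi_dec_eq mi_abs_Suc)

lemma mi_fact_dec: "n j \<noteq> 0 \<Longrightarrow> mi_fact n = n j * mi_fact (n(j := n j - 1))" for n :: "'m::finite mi"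
  using mi_fact_Suc[of "n(j := n j - 1)" j] by simp

lemma mi_pow_dec: "n j \<noteq> 0 \<Longrightarrow> mi_pow z n = z $ j * mi_pow z (n(j := n j - 1))"
  using mi_pow_Suc[of z "n(j := n j - 1)" j] by simp

lemma mi_abs_eq_0: "mi_abs n = 0 \<longleftrightarrow> n = (\<lambda>_. 0)" for n :: "'m::finite mi"
  by (auto simp: mi_abs_def fun_eq_iff)

lemma mi_abs_0 [simp]: "mi_abs (\<lambda>_. 0 :: nat) = 0"
  by (simp add: mi_abs_def)

lemma mi_pow_0 [simp]: "mi_pow z (\<lambda>_. 0) = 1"
  by (simp add: mi_pow_def)

lemma mi_fact_pos: "mi_fact n > 0"
  by (simp add: mi_fact_def prod_pos)

lemma mi_induct [case_names zero Suc]: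
  fixes n :: "'m::finite mi"
  assumes "P (\<lambda>_. 0)" "\<And>n j. P n \<Longrightarrow> P (n(j := Suc (n j)))"
  shows "P n"
proof (induction "mi_abs n" arbitrary: n)
  case 0
  then show ?case using assms(1) mi_abs_eq_0[of n] by simp
next
  case (Suc k)
  then obtain j where j: "n j \<noteq> 0"
    by (metis mi_abs_eq_0 nat.distinct(1) ext)
  then show ?case
    using assms(2)[of "n(j := n j - 1)" j] Suc mi_abs_dec[of n j] by simp
qed

lemma sum_mi_abs_Suc:
  fixes f :: "'m::finite mi \<Rightarrow> 'b::comm_monoid_add"
  assumes "\<And>n. n j = 0 \<Longrightarrow> f n = 0"
  shows "(\<Sum>n | mi_abs n = Suc k. f n) = (\<Sum>n | mi_abs n = k. f (n(j := Suc (n j))))"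
proof -
  have "(\<Sum>n | mi_abs n = Suc k. f n) = (\<Sum>n | mi_abs n = Suc k \<and> n j \<noteq> 0. f n)"
    by (rule sum.mono_neutral_right) (use assms finite_mi_abs in auto)
  also have "\<dots> = (\<Sum>n | mi_abs n = k. f (n(j := Suc (n j))))"
    by (rule sum.reindex_bij_witness[of _ "\<lambda>n. n(j := Suc (n j))" "\<lambda>n. n(j := n j - 1)"])
      (auto simp: mi_abs_Suc mi_abs_dec)
  finally show ?thesis .
qed

lemma hom_part_Mz_0: "hom_part (Mz j a) 0 z = 0"
  by (simp add: hom_part_eq mi_abs_eq_0 Mz_def)

lemma hom_part_Mz_Suc: "hom_part (Mz j a) (Suc k) z = z $ j * hom_part a k z"
  by (simp add: hom_part_eq sum_mi_abs_Suc[where j = j] Mz_def mi_pow_Suc sum_distrib_left mult_ac)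

section \<open>Almost sure properties of points of the sphere, and orthogonality of
  monomials\<close>

lemma AE_lborel_component_nonzero: "AE x in lborel. \<forall>i. (x :: complex^'m::finite) $ i \<noteq> 0"
proof (subst AE_all_countable, rule allI)
  fix i :: 'm
  have "(axis i 1 :: complex^'m) \<noteq> 0"
    by (simp add: axis_eq_0_iff)
  \<comment> \<open>The inner product is the real one, so this hyperplane is Re x_i = 0; it contains
    all \<open>x\<close> with x_i = 0.\<close>
  then have "negligible {x :: complex^'m. axis i 1 \<bullet> x = 0}"
    using negligible_hyperplane[of "axis i 1 :: complex^'m" 0] by simp
  moreover have "{x :: complex^'m. axis i 1 \<bullet> x = 0} \<in> sets lborel"
    using closed_hyperplane[of "axis i 1 :: complex^'m" 0] by simp
  ultimately have "{x :: complex^'m. axis i 1 \<bullet> x = 0} \<in> null_sets lborel"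
    using null_sets_completion_iff negligible_iff_null_sets by blast
  then show "AE x in lborel. (x :: complex^'m) $ i \<noteq> 0"
    by (rule AE_I') (auto simp: inner_axis')
qed

text \<open>Radial projection gives a unit vector away from the origin, and it preserves
  nonvanishing of coordinates. Norm 1 bounds the monomials; nonzero coordinates make the moments
  strictly positive.\<close>

lemma AE_sphere_measure:
  "AE z in sphere_measure. norm z = 1 \<and> (\<forall>i. (z :: complex^'m::finite) $ i \<noteq> 0)"
proof -
  have "AE x in uniform_measure lborel (ball 0 1). norm (x /\<^sub>R norm x) = 1 \<and> (\<forall>i. ((x :: complex^'m) /\<^sub>R norm x) $ i \<noteq> 0)"
  proof (rule AE_uniform_measureI)
    show "AE x in lborel. x \<in> ball 0 1 \<longrightarrow> norm (x /\<^sub>R norm x) = 1 \<and> (\<forall>i. ((x :: complex^'m) /\<^sub>R norm x) $ i \<noteq> 0)"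
      using AE_lborel_component_nonzero
    proof eventually_elim
      case (elim x)
      then have "x \<noteq> 0" by auto
      with elim show ?case by simp
    qed
  qed simp
  moreover have "{z :: complex^'m. norm z = 1 \<and> (\<forall>i. z $ i \<noteq> 0)} \<in> sets borel"
  proof -
    have [measurable]: "(\<lambda>z :: complex^'m. z $ i) \<in> borel_measurable borel" for i
      by (intro borel_measurable_continuous_onI continuous_intros)
    show ?thesis by measurable
  qed
  ultimately show ?thesis
    unfolding sphere_measure_def by (subst AE_distr_iff) simp_all
qed

lemma continuous_on_mi_pow [continuous_intros]: "continuous_on A (\<lambda>z. mi_pow z n)"
  unfolding mi_pow_def by (intro continuous_intros)

lemma norm_mi_pow_le:
  assumes "norm z = 1" shows "norm (mi_pow z n) \<le> 1"
  using Finite_Cartesian_Product.norm_nth_le[of z] assms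
  by (auto simp: mi_pow_def norm_power simp flip: prod_norm intro!: prod_le_1 power_le_one)

lemma integrable_sphere_mi_pow:
  "integrable sphere_measure (\<lambda>z. mi_pow z n * cnj (mi_pow z l))"
proof -
  interpret prob_space "sphere_measure :: (complex^'a) measure" by (rule prob_space_sphere_measure)
  show ?thesis
  proof (rule integrable_const_bound[where B = 1])
    show "AE z in sphere_measure. norm (mi_pow z n * cnj (mi_pow z l)) \<le> 1"
      using AE_sphere_measure by eventually_elim (auto simp: norm_mult norm_mi_pow_le intro: mult_le_one)
  qed (auto simp: measurable_cong_sets[OF sets_sphere_measure refl] intro!: borel_measurable_continuous_onI continuous_intros)
qed

lemma sphere_integral_unitary:
  fixes f :: "complex^'m::finite \<Rightarrow> 'b::{banach, second_countable_topology}"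
  assumes "unitary_matrix U" and f: "f \<in> borel_measurable borel"
  shows "(\<integral>z. f (U *v z) \<partial>sphere_measure) = (\<integral>z. f z \<partial>sphere_measure)"
proof -
  have "(\<integral>z. f z \<partial>sphere_measure) = (\<integral>z. f z \<partial>distr sphere_measure borel (\<lambda>z. U *v z))"
    by (simp add: distr_sphere_measure_unitary[OF assms(1)])
  also have "\<dots> = (\<integral>z. f (U *v z) \<partial>sphere_measure)"
    by (rule integral_distr)
      (use f orthogonal_transformation_borel_measurable[OF orthogonal_transformation_unitary[OF assms(1)]] in simp_all)
  finally show ?thesis ..
qed

text \<open>Rotating one coordinate in which the exponents differ by a suitable angle reverses the
  sign of the integrand, so the integral equals its own negative.\<close>

lemma sphere_mi_pow_orthogonal:
  fixes n l :: "'m::finite mi"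
  assumes "n \<noteq> l"
  shows "(\<integral>z. mi_pow z n * cnj (mi_pow z l) \<partial>sphere_measure) = 0"
proof -
  obtain i where i: "n i \<noteq> l i" using assms by auto
  \<comment> \<open>With this angle the integrand picks up the factor cis ((n_i - l_i) t) = cis pi =
    -1. The difference is taken in the reals because it may be negative.\<close>
  define t where "t = pi / (real (n i) - real (l i))"
  define d where "d a = (if a = i then cis t else 1)" for a
  define U :: "complex^'m^'m" where "U = (\<chi> a b. if a = b then d a else 0)"
  have d1: "cnj (d a) * d a = 1" "d a * cnj (d a) = 1" for a
    by (simp_all add: d_def cis_cnj cis_mult)
  have U: "unitary_matrix U"
    by (auto simp: unitary_matrix_def U_def matrix_matrix_mult_def mat_def vec_eq_iff d1
        if_distrib[of cnj] if_distrib[of "\<lambda>x. x * _"] if_distrib[of "\<lambda>x. _ * x"] cong: if_cong)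
  have Uz: "(U *v z) $ a = d a * z $ a" for z a
    by (simp add: U_def matrix_vector_mult_def if_distrib[of "\<lambda>x. x * _"] cong: if_cong)
  have pw: "mi_pow (U *v z) k = cis (real (k i) * t) * mi_pow z k" for z k
  proof -
    have "mi_pow (U *v z) k = (\<Prod>a\<in>UNIV. d a ^ k a) * mi_pow z k"
      by (simp add: mi_pow_def Uz power_mult_distrib prod.distrib)
    also have "(\<Prod>a\<in>UNIV. d a ^ k a) = cis (real (k i) * t)"
      by (simp add: d_def prod.remove[of UNIV i]) (rule Complex.DeMoivre)
    finally show ?thesis .
  qed
  have "cis (real (n i) * t) * cnj (cis (real (l i) * t)) = cis ((real (n i) - real (l i)) * t)"
    by (simp add: cis_cnj cis_mult algebra_simps)
  also have "\<dots> = - 1"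
    using i by (simp add: t_def)
  finally have c: "cis (real (n i) * t) * cnj (cis (real (l i) * t)) = - 1" .
  let ?F = "\<lambda>z. mi_pow z n * cnj (mi_pow z l)"
  have F: "?F (U *v z) = - ?F z" for z
  proof -
    have "?F (U *v z) = (cis (real (n i) * t) * cnj (cis (real (l i) * t))) * ?F z"
      by (simp add: pw)
    then show ?thesis unfolding c by simp
  qed
  have "(\<integral>z. ?F z \<partial>sphere_measure) = (\<integral>z. ?F (U *v z) \<partial>sphere_measure)"
    by (rule sphere_integral_unitary[OF U, symmetric]) (auto intro!: borel_measurable_continuous_onI continuous_intros)
  also have "\<dots> = - (\<integral>z. ?F z \<partial>sphere_measure)"
    unfolding F by simp
  finally show ?thesis by simp
qed

section \<open>Moments of the surface measure\<close>

definition sphere_moment :: "'m::finite mi \<Rightarrow> real" where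
  "sphere_moment n = (\<integral>z. (cmod (mi_pow z n))\<^sup>2 \<partial>sphere_measure)"

text \<open>Pythagoras for the orthogonal monomials of degree \<open>k\<close>. The computation runs
  over the complex numbers, where |w|^2 = w \<open>cnj w\<close> turns the square into a double
  sum.\<close>

lemma hom_L2_normsq_eq:
  fixes a :: "'m::finite series"
  shows "hom_L2_normsq a k = (\<Sum>n | mi_abs n = k. (cmod (a n))\<^sup>2 * sphere_moment n)"
proof -
  let ?S = "{n::'m mi. mi_abs n = k}"
  have sq: "complex_of_real ((cmod w)\<^sup>2) = w * cnj w" for w
    by (rule complex_norm_square)
  have "complex_of_real (hom_L2_normsq a k) = (\<integral>z. hom_part a k z * cnj (hom_part a k z) \<partial>sphere_measure)"
    unfolding hom_L2_normsq_def integral_complex_of_real[symmetric] sq ..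
  also have "\<dots> = (\<integral>z. (\<Sum>n\<in>?S. \<Sum>l\<in>?S. (a n * cnj (a l)) * (mi_pow z n * cnj (mi_pow z l))) \<partial>sphere_measure)"
    by (simp add: hom_part_eq sum_product mult_ac)
  also have "\<dots> = (\<Sum>n\<in>?S. \<Sum>l\<in>?S. (a n * cnj (a l)) * (\<integral>z. mi_pow z n * cnj (mi_pow z l) \<partial>sphere_measure))"
    by (simp add: Bochner_Integration.integral_sum integrable_sphere_mi_pow)
  also have "\<dots> = (\<Sum>n\<in>?S. \<Sum>l\<in>?S. if l = n then a n * cnj (a n) * (\<integral>z. mi_pow z n * cnj (mi_pow z n) \<partial>sphere_measure) else 0)"
    by (intro sum.cong refl) (auto simp: sphere_mi_pow_orthogonal)
  also have "\<dots> = (\<Sum>n\<in>?S. a n * cnj (a n) * (\<integral>z. mi_pow z n * cnj (mi_pow z n) \<partial>sphere_measure))"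
    by (simp add: finite_mi_abs)
  also have "\<dots> = (\<Sum>n\<in>?S. complex_of_real ((cmod (a n))\<^sup>2 * sphere_moment n))"
    unfolding sphere_moment_def of_real_mult integral_complex_of_real[symmetric] sq ..
  also have "\<dots> = complex_of_real (\<Sum>n\<in>?S. (cmod (a n))\<^sup>2 * sphere_moment n)"
    by simp
  finally show ?thesis using of_real_eq_iff by blast
qed

lemma integrable_sphere_moment: "integrable sphere_measure (\<lambda>z. (cmod (mi_pow z n))\<^sup>2)"
proof -
  have "integrable sphere_measure (\<lambda>z. complex_of_real ((cmod (mi_pow z n))\<^sup>2))"
    unfolding complex_norm_square by (rule integrable_sphere_mi_pow)
  then show ?thesis using integrable_Re by fastforce
qed

text \<open>The integrand is nonnegative and vanishes only where some coordinate does, which is a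
  null set.\<close>

lemma sphere_moment_pos: "sphere_moment n > 0" for n :: "'m::finite mi"
proof -
  interpret prob_space "sphere_measure :: (complex^'m) measure" by (rule prob_space_sphere_measure)
  have "sphere_moment n \<ge> 0"
    unfolding sphere_moment_def by (rule Bochner_Integration.integral_nonneg) simp
  moreover have "sphere_moment n \<noteq> 0"
  proof
    assume "sphere_moment n = 0"
    then have "AE z in sphere_measure. (cmod (mi_pow z n))\<^sup>2 = 0"
      unfolding sphere_moment_def
      by (subst (asm) integral_nonneg_eq_0_iff_AE) (auto intro: integrable_sphere_moment)
    with AE_sphere_measure have "AE z in (sphere_measure :: (complex^'m) measure). False"
      by eventually_elim (auto simp: mi_pow_def)
    then show False by (simp add: AE_False)
  qed
  ultimately show ?thesis by simp
qed

lemma sphere_moment_0: "sphere_moment (\<lambda>_::'m::finite. 0) = 1"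
proof -
  interpret prob_space "sphere_measure :: (complex^'m) measure" by (rule prob_space_sphere_measure)
  show ?thesis by (simp add: sphere_moment_def prob_space)
qed

text \<open>Integrates |z_1|^2 + ... + |z_m|^2 = 1 against |z^n|^2. This recursion later fixes the
  values of the moments.\<close>

lemma sum_sphere_moment_Suc: "(\<Sum>i\<in>UNIV. sphere_moment (n(i := Suc (n i)))) = sphere_moment n"
  for n :: "'m::finite mi"
proof -
  have "(\<Sum>i\<in>UNIV. sphere_moment (n(i := Suc (n i))))
      = (\<integral>z. (\<Sum>i\<in>UNIV. (cmod (mi_pow z (n(i := Suc (n i)))))\<^sup>2) \<partial>sphere_measure)"
    unfolding sphere_moment_def
    by (rule Bochner_Integration.integral_sum[symmetric]) (rule integrable_sphere_moment)
  also have "\<dots> = sphere_moment n"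
    unfolding sphere_moment_def
  proof (rule integral_cong_AE)
    show "AE z in sphere_measure. (\<Sum>i\<in>UNIV. (cmod (mi_pow z (n(i := Suc (n i)))))\<^sup>2) = (cmod (mi_pow z n))\<^sup>2"
      using AE_sphere_measure
    proof eventually_elim
      case (elim z)
      then have "(\<Sum>i\<in>UNIV. (cmod (z $ i))\<^sup>2) = 1"
        by (simp add: norm_vec_def L2_set_def)
      then show ?case
        by (simp add: mi_pow_Suc norm_mult power_mult_distrib flip: sum_distrib_right)
    qed
  qed (auto simp: measurable_cong_sets[OF sets_sphere_measure refl] intro!: borel_measurable_continuous_onI continuous_intros)
  finally show ?thesis .
qed

text \<open>A homogeneous polynomial that vanishes as a function has zero norm in L^2(\<sigma>), and
  positivity of the moments then kills every coefficient. It lets identities between series be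
  checked by evaluation at points.\<close>

lemma hom_part_inject:
  fixes a b :: "'m::finite series"
  assumes "\<And>z. hom_part a k z = hom_part b k z" and n: "mi_abs n = k"
  shows "a n = b n"
proof -
  let ?c = "\<lambda>n. a n - b n"
  have "hom_part ?c k z = 0" for z
    using assms(1)[of z] by (simp add: hom_part_eq algebra_simps sum_subtractf)
  then have "(\<Sum>n | mi_abs n = k. (cmod (?c n))\<^sup>2 * sphere_moment n) = 0"
    unfolding hom_L2_normsq_eq[symmetric] by (simp add: hom_L2_normsq_def)
  then have "(cmod (?c n))\<^sup>2 * sphere_moment n = 0"
    by (subst (asm) sum_nonneg_eq_0_iff) (auto simp: finite_mi_abs n less_imp_le[OF sphere_moment_pos])
  then show ?thesis using sphere_moment_pos[of n] by simp
qed

section \<open>Linear substitutions and invariant weights\<close>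

definition mi_monom :: "'m mi \<Rightarrow> 'm series" where
  "mi_monom n = (\<lambda>l. if l = n then 1 else 0)"

lemma hom_part_monom: "hom_part (mi_monom n) k z = (if mi_abs n = k then mi_pow z n else 0)"
  by (simp add: hom_part_eq mi_monom_def if_distrib[of "\<lambda>x. x * _"] finite_mi_abs cong: if_cong)

lemma Mz_monom: "Mz j (mi_monom n) = mi_monom (n(j := Suc (n j)))"
  by (auto simp: Mz_def mi_monom_def fun_eq_iff split: if_splits)

lemma hom_part_add: "hom_part (\<lambda>n. a n + b n) k z = hom_part a k z + hom_part b k z"
  by (simp add: hom_part_eq algebra_simps sum.distrib)

lemma hom_part_scale: "hom_part (\<lambda>n. c * a n) k z = c * hom_part a k z"
  by (simp add: hom_part_eq algebra_simps sum_distrib_left)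

lemma hom_part_sum: "hom_part (\<lambda>n. \<Sum>i\<in>A. c i * f i n) k z = (\<Sum>i\<in>A. c i * hom_part (f i) k z)"
  by (simp add: hom_part_eq sum_distrib_left sum_distrib_right mult_ac) (rule sum.swap)

text \<open>Induction on the exponent: one more factor (U z)_j is the combination of the operators
  \<open>Mz k\<close> with coefficients from row \<open>j\<close> of \<open>U\<close>.\<close>

lemma mi_pow_linear_subst:
  fixes U :: "complex^'m::finite^'m"
  shows "\<exists>c. \<forall>z. hom_part c (mi_abs n) z = mi_pow (U *v z) n"
proof (induction n rule: mi_induct)
  case zero
  show ?case by (rule exI[of _ "mi_monom (\<lambda>_. 0)"]) (simp add: hom_part_monom)
next
  case (Suc n j)
  then obtain c where c: "\<And>z. hom_part c (mi_abs n) z = mi_pow (U *v z) n" by blast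
  have "hom_part (\<lambda>l. \<Sum>k\<in>UNIV. U $ j $ k * Mz k c l) (mi_abs (n(j := Suc (n j)))) z
      = mi_pow (U *v z) (n(j := Suc (n j)))" for z
    unfolding mi_abs_Suc mi_pow_Suc hom_part_sum hom_part_Mz_Suc c
    by (simp add: matrix_vector_mult_def sum_distrib_right mult_ac)
  then show ?case by blast
qed

lemma hom_part_linear_subst:
  fixes U :: "complex^'m::finite^'m"
  shows "\<exists>c. \<forall>z. hom_part c k z = hom_part a k (U *v z)"
proof -
  obtain C where C: "\<And>n z. hom_part (C n) (mi_abs n) z = mi_pow (U *v z) n"
    using mi_pow_linear_subst[of _ U] by metis
  show ?thesis
    by (rule exI[of _ "\<lambda>l. \<Sum>n | mi_abs n = k. a n * C n l"])
      (auto simp: hom_part_sum hom_part_eq[of a] C intro!: sum.cong)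
qed

text \<open>The formal counterpart of \<open>f \<mapsto> f \<circ> U\<close>, assembled from the homogeneous parts.\<close>
definition linear_subst :: "complex^'m::finite^'m \<Rightarrow> 'm series \<Rightarrow> 'm series" where
  "linear_subst U a n = (SOME c. \<forall>z. hom_part c (mi_abs n) z = hom_part a (mi_abs n) (U *v z)) n"

lemma hom_part_linear_subst_eq: "hom_part (linear_subst U a) k z = hom_part a k (U *v z)"
proof -
  let ?c = "SOME c. \<forall>z. hom_part c k z = hom_part a k (U *v z)"
  have "hom_part (linear_subst U a) k z = hom_part ?c k z"
    by (simp add: hom_part_eq linear_subst_def)
  then show ?thesis using someI_ex[OF hom_part_linear_subst[of k a U]] by simp
qed

text \<open>Values at points determine a series, so the choice made in \<open>linear_subst\<close>
  is harmless and its algebraic laws reduce to identities between functions.\<close>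

lemma linear_subst_eqI:
  assumes "\<And>k z. hom_part b k z = hom_part a k (U *v z)"
  shows "linear_subst U a = b"
  using hom_part_inject[of "linear_subst U a" _ b] assms by (auto simp: hom_part_linear_subst_eq)

lemma linear_subst_add: "linear_subst U (\<lambda>n. a n + b n) = (\<lambda>n. linear_subst U a n + linear_subst U b n)"
  by (rule linear_subst_eqI) (simp add: hom_part_add hom_part_linear_subst_eq)

lemma linear_subst_scale: "linear_subst U (\<lambda>n. c * a n) = (\<lambda>n. c * linear_subst U a n)"
  by (rule linear_subst_eqI) (simp add: hom_part_scale hom_part_linear_subst_eq)

lemma linear_subst_sum:
  "linear_subst U (\<lambda>n. \<Sum>i\<in>A. c i * f i n) = (\<lambda>n. \<Sum>i\<in>A. c i * linear_subst U (f i) n)"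
  by (rule linear_subst_eqI) (simp add: hom_part_sum hom_part_linear_subst_eq)

text \<open>(z_j f) o U = (U z)_j (f o U). This is the relation demanded of the intertwiner, so
  \<open>linear_subst U\<close> is the candidate for it and the model to which any other one is
  compared.\<close>

lemma linear_subst_Mz: "linear_subst U (Mz j a) = (\<lambda>n. \<Sum>k\<in>UNIV. U $ j $ k * Mz k (linear_subst U a) n)"
proof (rule linear_subst_eqI)
  fix k z
  show "hom_part (\<lambda>n. \<Sum>k\<in>UNIV. U $ j $ k * Mz k (linear_subst U a) n) k z = hom_part (Mz j a) k (U *v z)"
    by (cases k) (simp_all add: hom_part_sum hom_part_Mz_0 hom_part_Mz_Suc hom_part_linear_subst_eq
        matrix_vector_mult_def sum_distrib_right mult_ac)
qed

text \<open>Composition reverses the order: substituting \<open>U\<close> first and \<open>V\<close>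
  afterwards gives f o (U V).\<close>

lemma linear_subst_inverse:
  assumes "U ** V = mat 1" shows "linear_subst V (linear_subst U a) = a"
  by (rule linear_subst_eqI) (simp add: hom_part_linear_subst_eq matrix_vector_mul_assoc assms)

lemma linear_subst_monom_0: "linear_subst U (mi_monom (\<lambda>_. 0)) = mi_monom (\<lambda>_. 0)"
  by (rule linear_subst_eqI) (auto simp: hom_part_monom)

lemma hom_L2_normsq_linear_subst:
  assumes "unitary_matrix U"
  shows "hom_L2_normsq (linear_subst U a) k = hom_L2_normsq a k"
  unfolding hom_L2_normsq_def hom_part_linear_subst_eq
  by (rule sphere_integral_unitary[OF assms, of "\<lambda>z. (cmod (hom_part a k z))\<^sup>2"])
    (auto simp: hom_part_eq intro!: borel_measurable_continuous_onI continuous_intros)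

text \<open>The multinomial expansion of (U z)_i^K, obtained by induction on \<open>K\<close>
  through the intertwining relation.\<close>

lemma linear_subst_monom_single:
  fixes l :: "'m::finite mi"
  shows "linear_subst U (mi_monom (\<lambda>j. if j = i then K else 0)) l
    = (if mi_abs l = K then fact K / of_nat (mi_fact l) * mi_pow (U $ i) l else 0)"
proof (induction K arbitrary: l)
  case 0
  show ?case
    by (simp add: linear_subst_monom_0) (auto simp: mi_monom_def mi_abs_eq_0 mi_fact_def)
next
  case (Suc K)
  have "(\<lambda>j. if j = i then K else 0)(i := Suc K) = (\<lambda>j. if j = i then Suc K else 0)"
    by auto
  then have eq: "mi_monom (\<lambda>j. if j = i then Suc K else 0) = Mz i (mi_monom (\<lambda>j. if j = i then K else 0))"
    by (simp add: Mz_monom)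
  have "linear_subst U (mi_monom (\<lambda>j. if j = i then Suc K else 0)) l
      = (\<Sum>k\<in>UNIV. U $ i $ k * Mz k (linear_subst U (mi_monom (\<lambda>j. if j = i then K else 0))) l)"
    unfolding eq linear_subst_Mz ..
  \<comment> \<open>Removing one factor z_k from z^l divides l! by l_k, which is why the summand
    carries l_k. These add up to |l| = K + 1 and turn K! into (K + 1)!.\<close>
  also have "\<dots> = (\<Sum>k\<in>UNIV. if mi_abs l = Suc K then fact K / of_nat (mi_fact l) * mi_pow (U $ i) l * of_nat (l k) else 0)"
  proof (rule sum.cong[OF refl])
    fix k
    show "U $ i $ k * Mz k (linear_subst U (mi_monom (\<lambda>j. if j = i then K else 0))) l
       = (if mi_abs l = Suc K then fact K / of_nat (mi_fact l) * mi_pow (U $ i) l * of_nat (l k) else 0)"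
    proof (cases "l k = 0")
      case False
      define l' where "l' = l(k := l k - 1)"
      have "mi_abs l = Suc (mi_abs l')" "mi_fact l = l k * mi_fact l'" "mi_pow (U $ i) l = U $ i $ k * mi_pow (U $ i) l'"
        unfolding l'_def by (rule mi_abs_dec mi_fact_dec mi_pow_dec, rule False)+
      moreover have "Mz k a l = a l'" for a :: "'m series"
        using False by (simp add: Mz_def l'_def)
      ultimately show ?thesis
        using False mi_fact_pos[of l'] by (simp add: Suc.IH field_simps)
    qed (simp add: Mz_def)
  qed
  also have "\<dots> = (if mi_abs l = Suc K then fact (Suc K) / of_nat (mi_fact l) * mi_pow (U $ i) l else 0)"
  proof (cases "mi_abs l = Suc K")
    case True
    then have "(\<Sum>k\<in>UNIV. complex_of_nat (l k)) = of_nat (Suc K)"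
      unfolding mi_abs_def by (metis of_nat_sum)
    with True show ?thesis
      unfolding if_P[OF True] sum_distrib_left[symmetric] by (simp add: algebra_simps)
  qed simp
  finally show ?case .
qed

text \<open>At the \<open>i\<close>-th unit vector every monomial of degree \<open>k\<close> except
  z_i^k vanishes. A coefficient thus becomes a value, to which
  \<open>hom_part_linear_subst_eq\<close> applies.\<close>

lemma hom_part_axis:
  "hom_part a k (axis i 1) = a (\<lambda>j. if j = i then k else 0)" for a :: "'m::finite series"
proof -
  have "mi_pow (axis i 1) n = (if n = (\<lambda>j. if j = i then k else 0) then 1 else 0)" if "mi_abs n = k" for n :: "'m mi"
  proof (cases "\<exists>j. j \<noteq> i \<and> n j \<noteq> 0")
    case True
    then show ?thesis by (auto simp: mi_pow_def axis_def fun_eq_iff)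
  next
    case False
    then have "n = (\<lambda>j. if j = i then n i else 0)" by (auto simp: fun_eq_iff)
    moreover from this have "mi_abs n = n i"
      by (subst mi_abs_def, subst sum.remove[of UNIV i]) (use False in auto)
    ultimately show ?thesis using that False by (auto simp: mi_pow_def axis_def intro!: prod.neutral)
  qed
  moreover have "mi_abs (\<lambda>j. if j = i then k else 0) = k"
    by (simp add: mi_abs_def)
  ultimately show ?thesis
    by (simp add: hom_part_eq finite_mi_abs if_distrib[of "\<lambda>x. _ * x"] cong: if_cong)
qed

section \<open>Weights invariant under unitary substitutions\<close>

definition adjoint_matrix :: "complex^'m^'m \<Rightarrow> complex^'m^'m" where
  "adjoint_matrix U = (\<chi> i j. cnj (U $ j $ i))"

lemma unitary_matrix_adjoint: "unitary_matrix U \<Longrightarrow> unitary_matrix (adjoint_matrix U)"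
  by (simp add: unitary_matrix_def adjoint_matrix_def)

lemma unitary_matrix_inverse:
  assumes "unitary_matrix U"
  shows "U ** adjoint_matrix U = mat 1" "adjoint_matrix U ** U = mat 1"
  using assms by (simp_all add: unitary_matrix_def adjoint_matrix_def)

lemma unitary_matrix_nonzero_entries:
  obtains U :: "complex^'m::finite^'m" where "unitary_matrix U" "\<And>a b. U $ a $ b \<noteq> 0"
proof -
  \<comment> \<open>With J the all-ones matrix, I - c J is unitary exactly when m |c|^2 = 2 Re c.
    The nonzero real solution c = 2/m gives zero diagonal entries for m = 2; this \<open>c\<close>
    leaves imaginary part 1/m in every entry.\<close>
  define c where "c = (1 - \<i>) / of_nat CARD('m)"
  \<comment> \<open>\<open>U\<close> multiplies the vector \<open>(1, \<dots>, 1)\<close> by \<open>\<i>\<close> and fixes its orthogonal complement.\<close>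
  define U :: "complex^'m^'m" where "U = (\<chi> a b. (if a = b then 1 else 0) - c)"
  have c: "of_nat CARD('m) * (c * cnj c) = c + cnj c"
    by (simp add: c_def field_simps complex_eq_iff)
  have s: "(\<Sum>k\<in>UNIV. ((if a = k then 1 else 0) - d) * ((if k = b then 1 else 0) - e))
      = (if a = b then 1 else 0) - d - e + of_nat CARD('m) * (d * e)" for a b :: 'm and d e :: complex
    by (simp add: algebra_simps sum.distrib sum_subtractf if_distrib[of "\<lambda>x. x * _"]
        if_distrib[of "\<lambda>x. _ * x"] cong: if_cong)
  have ent: "U $ a $ b = (if a = b then 1 else 0) - c" "cnj (U $ b $ a) = (if a = b then 1 else 0) - cnj c" for a b
    by (auto simp: U_def)
  have "(\<Sum>k\<in>UNIV. cnj (U $ k $ a) * U $ k $ b) = (if a = b then 1 else 0)"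
    "(\<Sum>k\<in>UNIV. U $ a $ k * cnj (U $ b $ k)) = (if a = b then 1 else 0)" for a b
    unfolding ent(2) unfolding ent(1) s using c by (simp_all add: mult.commute)
  then have "unitary_matrix U"
    by (simp add: unitary_matrix_def matrix_matrix_mult_def mat_def vec_eq_iff)
  moreover have "U $ a $ b \<noteq> 0" for a b
    by (auto simp: U_def c_def complex_eq_iff)
  ultimately show ?thesis by (rule that)
qed

text \<open>Leaves one free parameter per degree. It is applied both to the moments of \<sigma> and
  to the squares of \<beta>, which makes their ratio a function of the degree.\<close>

lemma invariant_weight:
  fixes w :: "'m::finite mi \<Rightarrow> real"
  assumes inv: "\<And>U a k. unitary_matrix U \<Longrightarrow>
    (\<Sum>n | mi_abs n = k. (cmod (linear_subst U a n))\<^sup>2 * w n) = (\<Sum>n | mi_abs n = k. (cmod (a n))\<^sup>2 * w n)"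
  shows "fact (mi_abs l) * w l = real (mi_fact l) * w (\<lambda>j. if j = i then mi_abs l else 0)"
proof -
  define K where "K = mi_abs l"
  let ?S = "{n::'m mi. mi_abs n = K}"
  obtain U :: "complex^'m^'m" where U: "unitary_matrix U" and nz: "\<And>a b. U $ a $ b \<noteq> 0"
    using unitary_matrix_nonzero_entries by blast
  define B where "B a b = (\<Sum>n\<in>?S. a n * cnj (b n) * complex_of_real (w n))" for a b
  \<comment> \<open>Polarization: the hypothesis speaks of the quadratic form only, and the values c
    = 1 and c = \<i> recover the real and imaginary parts of \<open>B\<close>.\<close>
  have Q: "(\<Sum>n\<in>?S. (cmod (a n + c * b n))\<^sup>2 * w n)
      = (\<Sum>n\<in>?S. (cmod (a n))\<^sup>2 * w n) + (\<Sum>n\<in>?S. (cmod (c * b n))\<^sup>2 * w n) + 2 * Re (cnj c * B a b)" for a b c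
  proof -
    have "(cmod (a n + c * b n))\<^sup>2 * w n = (cmod (a n))\<^sup>2 * w n + (cmod (c * b n))\<^sup>2 * w n
        + 2 * Re (cnj c * (a n * cnj (b n) * complex_of_real (w n)))" for n
      unfolding cmod_power2 by (simp add: power2_eq_square algebra_simps)
    then show ?thesis
      by (simp add: B_def sum_distrib_left sum.distrib del: times_complex.sel)
  qed
  have "Re (cnj c * B (linear_subst U a) (linear_subst U b)) = Re (cnj c * B a b)" for a b c
    using Q[of "linear_subst U a" c "linear_subst U b"] Q[of a c b]
      inv[OF U, where k = K and a = "\<lambda>n. a n + c * b n"] inv[OF U, where k = K and a = a] inv[OF U, where k = K and a = "\<lambda>n. c * b n"]
    unfolding linear_subst_add linear_subst_scale by linarith
  from this[of 1] this[of \<i>]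
  have Binv: "B (linear_subst U a) (linear_subst U b) = B a b" for a b
    by (simp add: complex_eq_iff)
  define V where "V = adjoint_matrix U"
  have VU: "V ** U = mat 1" using unitary_matrix_inverse[OF U] by (simp add: V_def)
  let ?e = "\<lambda>j. if j = i then K else 0"
  have eS: "mi_abs ?e = K" by (simp add: mi_abs_def)
  let ?p = "mi_pow (U $ i) l"
  have p: "?p \<noteq> 0" using nz by (simp add: mi_pow_def)
  have "V *v axis i 1 = (\<chi> j. cnj (U $ i $ j))"
    by (simp add: V_def adjoint_matrix_def vec_eq_iff matrix_vector_mult_def axis_def if_distrib[of "\<lambda>x. _ * x"] cong: if_cong)
  then have b: "linear_subst V (mi_monom l) ?e = cnj ?p"
    unfolding hom_part_axis[symmetric] hom_part_linear_subst_eq hom_part_monom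
    by (simp add: K_def mi_pow_def)
  \<comment> \<open>The same pairing after and before applying \<open>U\<close>. Each has a monomial
    in one argument, so a single coefficient of the other survives: that of z^l in (U z)_i^K here,
    that of z_i^K in (V z)^l next.\<close>
  have "B (linear_subst U (mi_monom ?e)) (linear_subst U (linear_subst V (mi_monom l)))
      = linear_subst U (mi_monom ?e) l * w l"
    unfolding linear_subst_inverse[OF VU] B_def
    by (simp add: mi_monom_def[of l] finite_mi_abs if_distrib[of cnj] if_distrib[of "\<lambda>x. _ * x"]
        if_distrib[of "\<lambda>x. x * _"] K_def cong: if_cong)
  moreover have "B (mi_monom ?e) (linear_subst V (mi_monom l)) = ?p * w ?e"
    unfolding B_def
    by (simp add: mi_monom_def[of ?e] finite_mi_abs if_distrib[of "\<lambda>x. x * _"] eS b cong: if_cong)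
  ultimately have "fact K / of_nat (mi_fact l) * ?p * w l = ?p * w ?e"
    using Binv[of "mi_monom ?e" "linear_subst V (mi_monom l)"] linear_subst_monom_single[of U i K l]
    by (simp add: K_def)
  then have "fact K * complex_of_real (w l) = of_nat (mi_fact l) * w ?e"
    using p mi_fact_pos[of l] by (simp add: field_simps)
  then have "complex_of_real (fact K * w l) = complex_of_real (real (mi_fact l) * w ?e)"
    by simp
  then show ?thesis unfolding K_def of_real_eq_iff .
qed

text \<open>Invariance leaves one unknown \<open>c k\<close> per degree, and the sum rule for the
  moments gives c_k = (k + m) c_{k+1}, with c_0 = 1 because \<sigma> is a probability
  measure.\<close>

lemma sphere_moment_eq:
  fixes n :: "'m::finite mi"
  shows "sphere_moment n = fact (CARD('m) - 1) * real (mi_fact n) / fact (CARD('m) - 1 + mi_abs n)"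
proof -
  obtain i :: 'm where True by simp
  define e where "e k = (\<lambda>j. if j = i then k else 0)" for k :: nat
  define c where "c k = sphere_moment (e k) / fact k" for k
  have eq: "sphere_moment n = real (mi_fact n) * c (mi_abs n)" for n :: "'m mi"
    using invariant_weight[OF hom_L2_normsq_linear_subst[unfolded hom_L2_normsq_eq], of n i]
    by (simp add: e_def c_def field_simps)
  have step: "c k = c (Suc k) * (real k + real CARD('m))" for k
  proof -
    have k: "mi_abs (e k) = k" by (simp add: mi_abs_def e_def)
    have "(\<Sum>i\<in>UNIV. real (mi_fact ((e k)(i := Suc (e k i)))) * c (Suc k)) = real (mi_fact (e k)) * c k"
      using sum_sphere_moment_Suc[of "e k"] by (simp add: eq mi_abs_Suc k)
    \<comment> \<open>Raising the \<open>i\<close>-th exponent of \<open>e k\<close> multiplies the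
      factorial by that exponent plus 1; these factors add up to k + m.\<close>
    moreover have "(\<Sum>i\<in>UNIV. real (mi_fact ((e k)(i := Suc (e k i)))) * c (Suc k))
        = real (mi_fact (e k)) * c (Suc k) * (\<Sum>i\<in>UNIV. real (e k i) + 1)"
      unfolding sum_distrib_left by (rule sum.cong) (simp_all add: mi_fact_Suc algebra_simps)
    moreover have "(\<Sum>i\<in>UNIV. real (e k i) + 1) = real k + real CARD('m)"
      using k by (simp add: sum.distrib mi_abs_def flip: of_nat_sum)
    ultimately show ?thesis using mi_fact_pos[of "e k"] by simp
  qed
  have "c k = fact (CARD('m) - 1) / fact (CARD('m) - 1 + k)" for k
  proof (induction k)
    case 0
    have "e 0 = (\<lambda>_. 0)" by (auto simp: e_def)
    then show ?case by (simp add: c_def sphere_moment_0)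
  next
    case (Suc k)
    \<comment> \<open>Makes the truncated subtraction \<open>CARD('m) - 1\<close> a genuine
      predecessor.\<close>
    obtain d where d: "CARD('m) = Suc d" using gr0_implies_Suc[OF zero_less_card_finite] by blast
    have "fact (CARD('m) - 1 + Suc k) = (real k + real CARD('m)) * fact (CARD('m) - 1 + k)"
      by (simp add: d add.commute)
    moreover have "c (Suc k) = c k / (real k + real CARD('m))"
      unfolding step[of k] by (simp add: d)
    ultimately show ?case by (simp add: Suc)
  qed
  then show ?thesis by (simp add: eq)
qed

section \<open>Spherical multiplication tuples\<close>

text \<open>Presents the multi-indices as the disjoint union of the finite degree blocks, so that
  unordered sums can be regrouped by degree.\<close>

lemma mi_block_bij:
  "inj_on snd (Sigma UNIV (\<lambda>k. {n::'m::finite mi. mi_abs n = k}))"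
  "snd ` Sigma UNIV (\<lambda>k. {n::'m mi. mi_abs n = k}) = UNIV"
  by (auto simp: inj_on_def image_iff)

lemma sums_mi_blocks:
  fixes f :: "'m::finite mi \<Rightarrow> real"
  assumes "f summable_on UNIV"
  shows "(\<lambda>k. \<Sum>n | mi_abs n = k. f n) sums infsum f UNIV"
proof -
  have "((f \<circ> snd) has_sum infsum f UNIV) (Sigma UNIV (\<lambda>k. {n::'m mi. mi_abs n = k}))"
    using has_sum_infsum[OF assms]
    unfolding has_sum_reindex[OF mi_block_bij(1), symmetric] mi_block_bij(2) .
  then have "((\<lambda>k. \<Sum>n | mi_abs n = k. f n) has_sum infsum f UNIV) UNIV"
    by (rule has_sum_SigmaD) (simp add: finite_mi_abs has_sum_finite)
  then show ?thesis by (rule has_sum_imp_sums)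
qed

text \<open>Converse of the regrouping: for nonnegative terms, convergence of the block sums is
  enough.\<close>

lemma summable_on_mi_blocks:
  fixes f :: "'m::finite mi \<Rightarrow> real"
  assumes "\<And>n. f n \<ge> 0" "summable (\<lambda>k. \<Sum>n | mi_abs n = k. f n)"
  shows "f summable_on UNIV"
proof -
  have "(f \<circ> snd) summable_on (Sigma UNIV (\<lambda>k. {n::'m mi. mi_abs n = k}))"
  proof (rule summable_on_SigmaI)
    show "(\<lambda>k. \<Sum>n | mi_abs n = k. f n) summable_on UNIV"
      using assms by (subst summable_on_UNIV_nonneg_real_iff) (auto intro: sum_nonneg)
  qed (auto simp: assms finite_mi_abs has_sum_finite)
  then show ?thesis
    unfolding summable_on_reindex[OF mi_block_bij(1), symmetric] mi_block_bij(2) .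
qed

section \<open>Norm identities in \<open>H2 \<beta>\<close>\<close>

lemma H2_add:
  assumes "a \<in> H2 \<beta>" "b \<in> H2 \<beta>" shows "(\<lambda>n. a n + b n) \<in> H2 \<beta>"
proof -
  have "(\<lambda>n. 2 * ((cmod (a n))\<^sup>2 * (\<beta> n)\<^sup>2) + 2 * ((cmod (b n))\<^sup>2 * (\<beta> n)\<^sup>2)) summable_on UNIV"
    using assms by (intro summable_on_add summable_on_cmult_right) (auto simp: H2_def)
  moreover have "(cmod (x + y))\<^sup>2 * w \<le> 2 * ((cmod x)\<^sup>2 * w) + 2 * ((cmod y)\<^sup>2 * w)" if "w \<ge> 0" for x y w
  proof -
    have "(cmod (x + y))\<^sup>2 \<le> (cmod x + cmod y)\<^sup>2"
      by (intro power_mono norm_triangle_ineq) auto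
    also have "\<dots> \<le> 2 * (cmod x)\<^sup>2 + 2 * (cmod y)\<^sup>2"
      using sum_squares_bound[of "cmod x" "cmod y"] by (simp add: power2_sum)
    finally show ?thesis using mult_right_mono[OF _ that] by (fastforce simp: algebra_simps)
  qed
  ultimately show ?thesis
    unfolding H2_def mem_Collect_eq by (rule summable_on_comparison_test) auto
qed

lemma H2_scale: "a \<in> H2 \<beta> \<Longrightarrow> (\<lambda>n. c * a n) \<in> H2 \<beta>"
  by (simp add: H2_def norm_mult power_mult_distrib mult.assoc summable_on_cmult_right)

lemma H2_normsq_scale: "H2_normsq \<beta> (\<lambda>n. c * a n) = (cmod c)\<^sup>2 * H2_normsq \<beta> a"
  by (simp add: H2_normsq_def norm_mult power_mult_distrib mult.assoc infsum_cmult_right')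

lemma H2_homogeneous:
  fixes a :: "'m::finite series"
  shows "(\<lambda>n. if mi_abs n = k then a n else 0) \<in> H2 \<beta>"
    and "H2_normsq \<beta> (\<lambda>n. if mi_abs n = k then a n else 0) = (\<Sum>n | mi_abs n = k. (cmod (a n))\<^sup>2 * (\<beta> n)\<^sup>2)"
proof -
  let ?a = "\<lambda>n. if mi_abs n = k then a n else 0"
  have "((\<lambda>n. (cmod (?a n))\<^sup>2 * (\<beta> n)\<^sup>2) has_sum (\<Sum>n | mi_abs n = k. (cmod (a n))\<^sup>2 * (\<beta> n)\<^sup>2)) UNIV"
    by (rule has_sum_finite_neutralI[OF finite_mi_abs[of k]]) auto
  then show "?a \<in> H2 \<beta>" "H2_normsq \<beta> ?a = (\<Sum>n | mi_abs n = k. (cmod (a n))\<^sup>2 * (\<beta> n)\<^sup>2)"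
    by (auto simp: H2_def H2_normsq_def summable_on_def infsumI)
qed

lemma mi_monom_homogeneous: "mi_monom n = (\<lambda>l. if mi_abs l = mi_abs n then mi_monom n l else 0)"
  by (auto simp: mi_monom_def)

lemma H2_monom: "mi_monom n \<in> H2 \<beta>" for n :: "'m::finite mi"
  by (subst mi_monom_homogeneous) (rule H2_homogeneous)

lemma H2_normsq_monom: "H2_normsq \<beta> (mi_monom n) = (\<beta> n)\<^sup>2" for n :: "'m::finite mi"
  by (subst mi_monom_homogeneous, subst H2_homogeneous)
    (simp add: mi_monom_def finite_mi_abs if_distrib[of "\<lambda>x. x * _"] if_distrib[of "\<lambda>x. x ^ _"] if_distrib[of cmod] cong: if_cong)

text \<open>Orthogonality is expressed through disjoint supports, as \<open>H2 \<beta>\<close> is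
  given here by its norm and not by an inner product.\<close>

lemma H2_normsq_add_disjoint:
  assumes "a \<in> H2 \<beta>" "b \<in> H2 \<beta>" "\<And>n. a n = 0 \<or> b n = 0"
  shows "H2_normsq \<beta> (\<lambda>n. a n + b n) = H2_normsq \<beta> a + H2_normsq \<beta> b"
proof -
  have "(cmod (a n + b n))\<^sup>2 * (\<beta> n)\<^sup>2 = (cmod (a n))\<^sup>2 * (\<beta> n)\<^sup>2 + (cmod (b n))\<^sup>2 * (\<beta> n)\<^sup>2" for n
    using assms(3)[of n] by auto
  then show ?thesis
    using assms by (simp add: H2_normsq_def H2_def infsum_add)
qed

text \<open>Regroups the norm by degree. With \<open>beta_eq_sphere_moment\<close> as converse, the
  norm formula of the theorem amounts to a pointwise condition on \<beta>.\<close>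

lemma H2_normsq_sums:
  fixes a :: "'m::finite series"
  assumes \<beta>: "\<And>n. (\<beta> n)\<^sup>2 = (b (mi_abs n))\<^sup>2 * sphere_moment n" and "a \<in> H2 \<beta>"
  shows "(\<lambda>k. (b k)\<^sup>2 * hom_L2_normsq a k) sums H2_normsq \<beta> a"
proof -
  have "(b k)\<^sup>2 * hom_L2_normsq a k = (\<Sum>n | mi_abs n = k. (cmod (a n))\<^sup>2 * (\<beta> n)\<^sup>2)" for k
    by (simp add: hom_L2_normsq_eq sum_distrib_left \<beta> mult_ac)
  then show ?thesis
    using sums_mi_blocks[of "\<lambda>n. (cmod (a n))\<^sup>2 * (\<beta> n)\<^sup>2"] assms(2) by (simp add: H2_def H2_normsq_def)
qed

text \<open>Testing the norm formula on z^n leaves a single term of the series.\<close>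

lemma beta_eq_sphere_moment:
  fixes \<beta> :: "'m::finite mi \<Rightarrow> real"
  assumes "\<And>a. a \<in> H2 \<beta> \<Longrightarrow> (\<lambda>k. (b k)\<^sup>2 * hom_L2_normsq a k) sums H2_normsq \<beta> a"
  shows "(\<beta> n)\<^sup>2 = (b (mi_abs n))\<^sup>2 * sphere_moment n"
proof -
  have "hom_L2_normsq (mi_monom n) k = (if k = mi_abs n then sphere_moment n else 0)" for k
    by (auto simp: hom_L2_normsq_eq mi_monom_def finite_mi_abs if_distrib[of "\<lambda>x. x * _"]
        if_distrib[of "\<lambda>x. x ^ _"] if_distrib[of cmod] cong: if_cong)
  then have "(\<lambda>k. (b k)\<^sup>2 * hom_L2_normsq (mi_monom n) k)
      = (\<lambda>k. if k = mi_abs n then (b (mi_abs n))\<^sup>2 * sphere_moment n else 0)"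
    by auto
  then have "(\<lambda>k. (b k)\<^sup>2 * hom_L2_normsq (mi_monom n) k) sums ((b (mi_abs n))\<^sup>2 * sphere_moment n)"
    using sums_single[of "mi_abs n" "\<lambda>_. (b (mi_abs n))\<^sup>2 * sphere_moment n"] by simp
  with assms[OF H2_monom[of n]] show ?thesis
    unfolding H2_normsq_monom by (rule sums_unique2)
qed

section \<open>The two directions of the equivalence\<close>

lemma spherical_if_sphere_moment:
  fixes \<beta> :: "'m::finite mi \<Rightarrow> real"
  assumes \<beta>: "\<And>n. (\<beta> n)\<^sup>2 = (b (mi_abs n))\<^sup>2 * sphere_moment n"
  shows "Mz_spherical \<beta>"
  unfolding Mz_spherical_def
proof (intro allI impI)
  fix U :: "complex^'m^'m" assume U: "unitary_matrix U"
  have blk: "(\<Sum>n | mi_abs n = k. (cmod (a n))\<^sup>2 * (\<beta> n)\<^sup>2) = (b k)\<^sup>2 * hom_L2_normsq a k" for a k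
    by (simp add: hom_L2_normsq_eq sum_distrib_left \<beta> mult_ac)
  have H2: "linear_subst U a \<in> H2 \<beta>" if U: "unitary_matrix U" and a: "a \<in> H2 \<beta>" for U a
  proof -
    have "summable (\<lambda>k. \<Sum>n | mi_abs n = k. (cmod (linear_subst U a n))\<^sup>2 * (\<beta> n)\<^sup>2)"
      unfolding blk hom_L2_normsq_linear_subst[OF U]
      using H2_normsq_sums[OF \<beta> a] by (rule sums_summable)
    then show ?thesis
      unfolding H2_def mem_Collect_eq by (intro summable_on_mi_blocks) auto
  qed
  have nrm: "H2_normsq \<beta> (linear_subst U a) = H2_normsq \<beta> a" if a: "a \<in> H2 \<beta>" for a
    using H2_normsq_sums[OF \<beta> a] H2_normsq_sums[OF \<beta> H2[OF U a]]
    by (simp add: hom_L2_normsq_linear_subst[OF U] sums_unique2)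
  \<comment> \<open>The intertwiner is composition with \<open>U\<close>. Composition with the
    adjoint inverts it and also stays inside the space, since \<open>H2\<close> was shown for every
    unitary matrix.\<close>
  have "bij_betw (linear_subst U) (H2 \<beta>) (H2 \<beta>)"
    by (rule bij_betw_byWitness[of _ "linear_subst (adjoint_matrix U)"])
      (auto simp: linear_subst_inverse unitary_matrix_inverse[OF U] H2 U unitary_matrix_adjoint)
  then have "unitary_map (H2 \<beta>) (H2_norm \<beta>) (H2 \<beta>) (H2_norm \<beta>) (linear_subst U)"
    by (simp add: unitary_map_def linear_subst_add linear_subst_scale H2_norm_def nrm)
  then show "\<exists>\<Gamma>. unitary_map (H2 \<beta>) (H2_norm \<beta>) (H2 \<beta>) (H2_norm \<beta>) \<Gamma> \<and>
      (\<forall>j. \<forall>a\<in>H2 \<beta>. \<Gamma> (Mz j a) = (\<lambda>n. \<Sum>k\<in>UNIV. U $ j $ k * Mz k (\<Gamma> a) n))"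
    using linear_subst_Mz by blast
qed

lemma hom_part_homogeneous:
  "hom_part (\<lambda>n. if mi_abs n = k then a n else 0) l z = (if l = k then hom_part a k z else 0)"
  by (auto simp: hom_part_eq intro!: sum.neutral)

lemma linear_subst_homogeneous:
  "linear_subst U (\<lambda>n. if mi_abs n = k then a n else 0) = (\<lambda>n. if mi_abs n = k then linear_subst U a n else 0)"
  by (rule linear_subst_eqI) (simp add: hom_part_homogeneous hom_part_linear_subst_eq)

lemma spherical_imp_invariant:
  fixes \<beta> :: "'m::finite mi \<Rightarrow> real"
  assumes pos: "\<And>n. \<beta> n > 0" and bdd: "Mz_bounded \<beta>" and sph: "Mz_spherical \<beta>"
    and U: "unitary_matrix (U :: complex^'m^'m)"
  shows "(\<Sum>n | mi_abs n = k. (cmod (linear_subst U a n))\<^sup>2 * (\<beta> n)\<^sup>2) = (\<Sum>n | mi_abs n = k. (cmod (a n))\<^sup>2 * (\<beta> n)\<^sup>2)"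
proof -
  obtain \<Gamma> where uni: "unitary_map (H2 \<beta>) (H2_norm \<beta>) (H2 \<beta>) (H2_norm \<beta>) \<Gamma>"
    and Mz: "\<And>j a. a \<in> H2 \<beta> \<Longrightarrow> \<Gamma> (Mz j a) = (\<lambda>n. \<Sum>k\<in>UNIV. U $ j $ k * Mz k (\<Gamma> a) n)"
    using sph U unfolding Mz_spherical_def by blast
  have bij: "bij_betw \<Gamma> (H2 \<beta>) (H2 \<beta>)"
    and add: "\<And>a b. a \<in> H2 \<beta> \<Longrightarrow> b \<in> H2 \<beta> \<Longrightarrow> \<Gamma> (\<lambda>n. a n + b n) = (\<lambda>n. \<Gamma> a n + \<Gamma> b n)"
    and scale: "\<And>c a. a \<in> H2 \<beta> \<Longrightarrow> \<Gamma> (\<lambda>n. c * a n) = (\<lambda>n. c * \<Gamma> a n)"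
    and nrm: "\<And>a. a \<in> H2 \<beta> \<Longrightarrow> H2_normsq \<beta> (\<Gamma> a) = H2_normsq \<beta> a"
    using uni by (auto simp: unitary_map_def H2_norm_def)
  have MzH2: "Mz j a \<in> H2 \<beta>" if "a \<in> H2 \<beta>" for j a
    using bdd that by (auto simp: Mz_bounded_def)
  have GH2: "\<Gamma> a \<in> H2 \<beta>" if "a \<in> H2 \<beta>" for a
    using bij that by (auto simp: bij_betw_def)
  have comb: "(\<lambda>n. \<Sum>i\<in>A. c i * f i n) \<in> H2 \<beta> \<and>
      \<Gamma> (\<lambda>n. \<Sum>i\<in>A. c i * f i n) = (\<lambda>n. \<Sum>i\<in>A. c i * \<Gamma> (f i) n)"
    if "finite A" "\<And>i. i \<in> A \<Longrightarrow> f i \<in> H2 \<beta>" for A :: "'i set" and c and f :: "'i \<Rightarrow> 'm series"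
    using that
  proof (induction A rule: finite_induct)
    case empty
    have "(\<lambda>n. 0) \<in> H2 \<beta>" "\<Gamma> (\<lambda>n. 0) = (\<lambda>n. 0)"
      using H2_scale[OF H2_monom, where c = 0] scale[OF H2_monom, where c = 0] by simp_all
    then show ?case by simp
  next
    case (insert x A)
    then show ?case
      using add[of "\<lambda>n. c x * f x n" "\<lambda>n. \<Sum>i\<in>A. c i * f i n"] scale[of "f x" "c x"]
      by (simp add: H2_add H2_scale)
  qed
  define g where "g = \<Gamma> (mi_monom (\<lambda>_. 0))"
  have gH2: "g \<in> H2 \<beta>" unfolding g_def by (rule GH2[OF H2_monom])
  \<comment> \<open>Inverts the relation between the two tuples: z_k x = \<Gamma> y for y = \<Sum>_j
    conj(u_jk) z_j x', where \<Gamma> x' = x. Such a combination has no constant term.\<close>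
  have range: "\<exists>y\<in>H2 \<beta>. y (\<lambda>_. 0) = 0 \<and> \<Gamma> y = Mz k x" if "x \<in> H2 \<beta>" for k x
  proof -
    have "x \<in> \<Gamma> ` H2 \<beta>"
      using bij_betw_imp_surj_on[OF bij] that by simp
    then obtain x' where x': "x' \<in> H2 \<beta>" "\<Gamma> x' = x"
      by (elim imageE) simp
    define y where "y = (\<lambda>n. \<Sum>j\<in>UNIV. cnj (U $ j $ k) * Mz j x' n)"
    have "y \<in> H2 \<beta>" and Gy: "\<Gamma> y = (\<lambda>n. \<Sum>j\<in>UNIV. cnj (U $ j $ k) * \<Gamma> (Mz j x') n)"
      using comb[of UNIV "\<lambda>j. Mz j x'" "\<lambda>j. cnj (U $ j $ k)"] by (auto simp: y_def MzH2 x')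
    have "\<Gamma> y n = Mz k x n" for n
    proof -
      have "\<Gamma> y n = (\<Sum>j\<in>UNIV. \<Sum>l\<in>UNIV. (cnj (U $ j $ k) * U $ j $ l) * Mz l x n)"
        by (simp add: Gy Mz x' sum_distrib_left mult_ac)
      also have "\<dots> = (\<Sum>l\<in>UNIV. (\<Sum>j\<in>UNIV. cnj (U $ j $ k) * U $ j $ l) * Mz l x n)"
        unfolding sum_distrib_right by (rule sum.swap)
      also have "\<dots> = Mz k x n"
        by (simp add: unitary_matrix_columns[OF U] if_distrib[of "\<lambda>x. x * _"] cong: if_cong)
      finally show ?thesis .
    qed
    then have "\<Gamma> y = Mz k x" by blast
    with \<open>y \<in> H2 \<beta>\<close> show ?thesis by (intro bexI[of _ y]) (auto simp: y_def Mz_def)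
  qed
  \<comment> \<open>\<open>z^n = \<Gamma> y\<close> with \<open>y\<close> orthogonal to \<open>1\<close>, so \<open>z^n\<close> is orthogonal to \<open>g = \<Gamma> 1\<close>; this is read off the
    norm of \<open>\<Gamma> (1 + c y)\<close>.\<close>
  have g0: "g n = 0" if n: "n \<noteq> (\<lambda>_. 0)" for n
  proof -
    obtain j where j: "n j \<noteq> 0" using n by auto
    define m where "m = n(j := n j - 1)"
    have nm: "mi_monom n = Mz j (mi_monom m)"
      using j by (simp add: Mz_monom m_def)
    obtain y where y: "y \<in> H2 \<beta>" "y (\<lambda>_. 0) = 0" "\<Gamma> y = mi_monom n"
      using range[OF H2_monom, of j m] unfolding nm by blast
    define c where "c = g n"
    define h where "h = g(n := 0)"
    have g_eq: "g = (\<lambda>l. h l + c * mi_monom n l)"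
      by (auto simp: h_def c_def mi_monom_def)
    have "h = (\<lambda>l. g l + (- c) * mi_monom n l)"
      by (auto simp: h_def c_def mi_monom_def)
    then have hH2: "h \<in> H2 \<beta>"
      using H2_add[OF gH2 H2_scale[OF H2_monom], of "- c" n] by simp
    have h: "H2_normsq \<beta> (\<lambda>l. h l + d * mi_monom n l) = H2_normsq \<beta> h + (cmod d)\<^sup>2 * (\<beta> n)\<^sup>2" for d
      using H2_normsq_add_disjoint[OF hH2 H2_scale[OF H2_monom[of n]], of d]
      by (simp add: H2_normsq_scale H2_normsq_monom) (simp add: h_def mi_monom_def)
    have "\<Gamma> (\<lambda>l. mi_monom (\<lambda>_. 0) l + c * y l) = (\<lambda>l. g l + c * mi_monom n l)"
      by (simp add: add H2_scale H2_monom scale y g_def)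
    also have "\<dots> = (\<lambda>l. h l + (2 * c) * mi_monom n l)"
      by (subst g_eq) (simp add: algebra_simps)
    finally have G: "\<Gamma> (\<lambda>l. mi_monom (\<lambda>_. 0) l + c * y l) = (\<lambda>l. h l + (2 * c) * mi_monom n l)" .
    \<comment> \<open>The left side is ||h||^2 + 4 |c|^2 \<beta>_n^2, while the right side comes out
      as ||h||^2 + 2 |c|^2 \<beta>_n^2, which forces c = 0.\<close>
    have "H2_normsq \<beta> h + (cmod (2 * c))\<^sup>2 * (\<beta> n)\<^sup>2 = H2_normsq \<beta> (\<lambda>l. mi_monom (\<lambda>_. 0) l + c * y l)"
      unfolding h[symmetric] G[symmetric] by (rule nrm) (intro H2_add H2_scale H2_monom y)
    also have "\<dots> = H2_normsq \<beta> (mi_monom (\<lambda>_. 0)) + (cmod c)\<^sup>2 * H2_normsq \<beta> y"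
      unfolding H2_normsq_scale[symmetric]
      by (rule H2_normsq_add_disjoint) (use y in \<open>auto simp: mi_monom_def intro: H2_monom[unfolded mi_monom_def] H2_scale\<close>)
    also have "H2_normsq \<beta> (mi_monom (\<lambda>_. 0)) = H2_normsq \<beta> g"
      unfolding g_def by (rule nrm[symmetric]) (rule H2_monom)
    also have "\<dots> = H2_normsq \<beta> h + (cmod c)\<^sup>2 * (\<beta> n)\<^sup>2"
      unfolding h[symmetric] g_eq[symmetric] ..
    also have "H2_normsq \<beta> y = (\<beta> n)\<^sup>2"
      using nrm[OF y(1)] by (simp add: y H2_normsq_monom)
    finally have "(cmod c)\<^sup>2 * (\<beta> n)\<^sup>2 = 0"
      by (simp add: norm_mult power_mult_distrib)
    then show ?thesis using pos[of n] by (simp add: c_def)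
  qed
  define u where "u = g (\<lambda>_. 0)"
  have g: "g = (\<lambda>l. u * mi_monom (\<lambda>_. 0) l)"
    using g0 by (auto simp: u_def mi_monom_def)
  have "(cmod u)\<^sup>2 * (\<beta> (\<lambda>_. 0))\<^sup>2 = (\<beta> (\<lambda>_. 0))\<^sup>2"
    using nrm[OF H2_monom[of "\<lambda>_. 0"]] unfolding g_def[symmetric]
    by (subst (asm) g) (simp add: H2_normsq_scale H2_normsq_monom)
  then have u: "(cmod u)\<^sup>2 = 1" using pos[of "\<lambda>_. 0"] by simp
  \<comment> \<open>Both maps obey the same intertwining relation, so their agreement at 1 up to the
    factor \<open>u\<close> spreads to every monomial.\<close>
  have mon: "\<Gamma> (mi_monom n) = (\<lambda>l. u * linear_subst U (mi_monom n) l)" for n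
  proof (induction n rule: mi_induct)
    case zero
    show ?case using g by (simp add: g_def linear_subst_monom_0)
  next
    case (Suc n j)
    have "Mz k (\<lambda>l. u * a l) l = u * Mz k a l" for a :: "'m series" and k l by (simp add: Mz_def)
    then show ?case
      unfolding Mz_monom[symmetric] Mz[OF H2_monom] Suc linear_subst_Mz
      by (simp add: sum_distrib_left mult_ac)
  qed
  \<comment> \<open>The series \<open>a\<close> is arbitrary and may lie outside
    \<open>H2 \<beta>\<close>; its degree \<open>k\<close> part is a finite combination of
    monomials, on which \<Gamma> is known.\<close>
  let ?p = "\<lambda>n. if mi_abs n = k then a n else 0"
  have p: "?p = (\<lambda>n. \<Sum>m | mi_abs m = k. a m * mi_monom m n)"
    by (auto simp: mi_monom_def finite_mi_abs if_distrib[of "\<lambda>x. _ * x"] cong: if_cong)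
  have "\<Gamma> ?p = (\<lambda>n. \<Sum>m | mi_abs m = k. a m * (u * linear_subst U (mi_monom m) n))"
    unfolding p using comb[OF finite_mi_abs, of k mi_monom a] by (simp add: H2_monom mon)
  also have "\<dots> = (\<lambda>n. u * linear_subst U ?p n)"
    unfolding p linear_subst_sum by (simp add: sum_distrib_left mult_ac)
  finally have "H2_normsq \<beta> (\<lambda>n. u * linear_subst U ?p n) = H2_normsq \<beta> ?p"
    using nrm[OF H2_homogeneous(1), of k a] by simp
  then show ?thesis
    unfolding H2_normsq_scale u linear_subst_homogeneous H2_homogeneous by simp
qed

text \<open>The ratio of \<beta>_n^2 to the moment depends on |n| only, both being invariant
  weights. The square of b_k is this ratio read off at the pure power z_i^k for an arbitrary fixed
  axis.\<close>

lemma spherical_imp_sphere_moment: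
  fixes \<beta> :: "'m::finite mi \<Rightarrow> real"
  assumes pos: "\<And>n. \<beta> n > 0" and bdd: "Mz_bounded \<beta>" and sph: "Mz_spherical \<beta>"
  shows "\<exists>b. (\<forall>k. b k > 0) \<and> (\<forall>n. (\<beta> n)\<^sup>2 = (b (mi_abs n))\<^sup>2 * sphere_moment n)"
proof -
  obtain i :: 'm where True by simp
  define e where "e k = (\<lambda>j. if j = i then k else 0)" for k :: nat
  define b where "b k = sqrt ((\<beta> (e k))\<^sup>2 / sphere_moment (e k))" for k
  have b: "(b k)\<^sup>2 = (\<beta> (e k))\<^sup>2 / sphere_moment (e k)" for k
    by (simp add: b_def less_imp_le[OF sphere_moment_pos])
  have "(\<beta> n)\<^sup>2 = (b (mi_abs n))\<^sup>2 * sphere_moment n" for n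
  proof -
    let ?k = "mi_abs n"
    have 1: "fact ?k * (\<beta> n)\<^sup>2 = real (mi_fact n) * (\<beta> (e ?k))\<^sup>2"
      using invariant_weight[of "\<lambda>n. (\<beta> n)\<^sup>2" n i] spherical_imp_invariant[OF assms] by (simp add: e_def)
    have 2: "fact ?k * sphere_moment n = real (mi_fact n) * sphere_moment (e ?k)"
      using invariant_weight[OF hom_L2_normsq_linear_subst[unfolded hom_L2_normsq_eq], of n i] by (simp add: e_def)
    have "fact ?k * (\<beta> n)\<^sup>2 = (b ?k)\<^sup>2 * (real (mi_fact n) * sphere_moment (e ?k))"
      using sphere_moment_pos[of "e ?k"] by (simp add: 1 b)
    also have "\<dots> = fact ?k * ((b ?k)\<^sup>2 * sphere_moment n)"
      unfolding 2[symmetric] by simp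
    finally show ?thesis by simp
  qed
  moreover have "b k > 0" for k
    using pos[of "e k"] sphere_moment_pos[of "e k"] by (simp add: b_def)
  ultimately show ?thesis by blast
qed

section \<open>The shift weights and the model on \<open>l2\<close>\<close>

lemma sphere_moment_Suc:
  "sphere_moment (n(j := Suc (n j))) = sphere_moment n * ((real (n j) + 1) / (real (mi_abs n) + real CARD('m)))"
  for n :: "'m::finite mi"
proof -
  obtain d where "CARD('m) = Suc d" using gr0_implies_Suc[OF zero_less_card_finite] by blast
  then show ?thesis
    by (simp add: sphere_moment_eq mi_abs_Suc mi_fact_Suc algebra_simps)
qed

text \<open>The map sends the normalized monomial z^n / \<beta>_n to the basis vector e_n.\<close>

lemma unitary_map_to_l2:
  assumes pos: "\<And>n. \<beta> n > 0"
  shows "unitary_map (H2 \<beta>) (H2_norm \<beta>) l2 l2_norm (\<lambda>a n. complex_of_real (\<beta> n) * a n)"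
proof -
  have nz: "\<beta> n \<noteq> 0" for n using pos[of n] by simp
  have "bij_betw (\<lambda>a n. complex_of_real (\<beta> n) * a n) (H2 \<beta>) l2"
    by (rule bij_betw_byWitness[of _ "\<lambda>x n. x n / complex_of_real (\<beta> n)"])
      (auto simp: H2_def l2_def nz norm_mult norm_divide power_mult_distrib power_divide mult.commute)
  then show ?thesis
    by (auto simp: unitary_map_def algebra_simps H2_norm_def H2_normsq_def l2_norm_def norm_mult
        power_mult_distrib)
qed

theorem theorem2p1:
  fixes \<beta> :: "'m::finite mi \<Rightarrow> real"
  assumes pos: "\<And>n. \<beta> n > 0"
    and bdd: "Mz_bounded \<beta>"
  shows "(Mz_spherical \<beta> \<longleftrightarrow>
           (\<exists>b::nat \<Rightarrow> real. (\<forall>k. b k > 0) \<and>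
              (\<forall>a\<in>H2 \<beta>. (\<lambda>k. (b k)\<^sup>2 * hom_L2_normsq a k) sums H2_normsq \<beta> a)))
       \<and> (\<forall>b::nat \<Rightarrow> real. (\<forall>k. b k > 0) \<and>
              (\<forall>a\<in>H2 \<beta>. (\<lambda>k. (b k)\<^sup>2 * hom_L2_normsq a k) sums H2_normsq \<beta> a) \<longrightarrow>
            (\<exists>V. unitary_map (H2 \<beta>) (H2_norm \<beta>) l2 l2_norm V \<and>
                 (\<forall>j. \<forall>a\<in>H2 \<beta>. V (Mz j a) =
                    wshift (\<lambda>i n. b (mi_abs n + 1) / b (mi_abs n) *
                                  sqrt ((real (n i) + 1) / (real (mi_abs n) + real CARD('m)))) j (V a)))
            \<and> (\<forall>n. \<beta> n = b (mi_abs n) *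
                   sqrt (real (fact (CARD('m) - 1) * mi_fact n) / real (fact (CARD('m) - 1 + mi_abs n)))))"
proof (intro conjI allI impI)
  show "Mz_spherical \<beta> \<longleftrightarrow>
           (\<exists>b::nat \<Rightarrow> real. (\<forall>k. b k > 0) \<and>
              (\<forall>a\<in>H2 \<beta>. (\<lambda>k. (b k)\<^sup>2 * hom_L2_normsq a k) sums H2_normsq \<beta> a))"
  proof
    assume "Mz_spherical \<beta>"
    from spherical_imp_sphere_moment[OF pos bdd this] obtain b where
      "\<And>k. b k > 0" "\<And>n. (\<beta> n)\<^sup>2 = (b (mi_abs n))\<^sup>2 * sphere_moment n"
      by blast
    then show "\<exists>b::nat \<Rightarrow> real. (\<forall>k. b k > 0) \<and>
              (\<forall>a\<in>H2 \<beta>. (\<lambda>k. (b k)\<^sup>2 * hom_L2_normsq a k) sums H2_normsq \<beta> a)"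
      using H2_normsq_sums[of \<beta> b] by blast
  next
    assume "\<exists>b::nat \<Rightarrow> real. (\<forall>k. b k > 0) \<and>
              (\<forall>a\<in>H2 \<beta>. (\<lambda>k. (b k)\<^sup>2 * hom_L2_normsq a k) sums H2_normsq \<beta> a)"
    then obtain b where "\<And>a. a \<in> H2 \<beta> \<Longrightarrow> (\<lambda>k. (b k)\<^sup>2 * hom_L2_normsq a k) sums H2_normsq \<beta> a"
      by blast
    then show "Mz_spherical \<beta>"
      by (intro spherical_if_sphere_moment beta_eq_sphere_moment)
  qed
next
  fix b :: "nat \<Rightarrow> real"
  assume b: "(\<forall>k. b k > 0) \<and> (\<forall>a\<in>H2 \<beta>. (\<lambda>k. (b k)\<^sup>2 * hom_L2_normsq a k) sums H2_normsq \<beta> a)"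
  have \<beta>: "\<beta> n = b (mi_abs n) * sqrt (sphere_moment n)" for n
  proof (rule power2_eq_imp_eq)
    show "(\<beta> n)\<^sup>2 = (b (mi_abs n) * sqrt (sphere_moment n))\<^sup>2"
      using beta_eq_sphere_moment[of \<beta> b n] b by (simp add: power_mult_distrib less_imp_le[OF sphere_moment_pos])
  qed (use pos[of n] b in \<open>auto simp: less_imp_le sphere_moment_pos intro!: mult_nonneg_nonneg\<close>)
  show "\<beta> n = b (mi_abs n) *
      sqrt (real (fact (CARD('m) - 1) * mi_fact n) / real (fact (CARD('m) - 1 + mi_abs n)))" for n
    by (simp add: \<beta> sphere_moment_eq)
  let ?V = "\<lambda>a n. complex_of_real (\<beta> n) * a n"
  let ?w = "\<lambda>i n. b (mi_abs n + 1) / b (mi_abs n) * sqrt ((real (n i) + 1) / (real (mi_abs n) + real CARD('m)))"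
  \<comment> \<open>The shift weight is the quotient of consecutive norms ||z_j z^n|| / ||z^n||; the
    moments contribute the root of (n_j + 1) / (|n| + m) to it.\<close>
  have step: "\<beta> (n(j := Suc (n j))) = ?w j n * \<beta> n" for n j
  proof -
    have "sqrt (sphere_moment (n(j := Suc (n j))))
        = sqrt ((real (n j) + 1) / (real (mi_abs n) + real CARD('m))) * sqrt (sphere_moment n)"
      unfolding sphere_moment_Suc real_sqrt_mult by (rule mult.commute)
    then show ?thesis
      using b[THEN conjunct1, THEN spec, of "mi_abs n"] by (simp add: \<beta> mi_abs_Suc)
  qed
  have "?V (Mz j a) = wshift ?w j (?V a)" for j a
  proof
    fix n
    show "?V (Mz j a) n = wshift ?w j (?V a) n"
    proof (cases "n j = 0")
      case False
      define m where "m = n(j := n j - 1)"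
      have n: "n = m(j := Suc (m j))" using False by (auto simp: m_def)
      have "Mz j a n = a m" "wshift ?w j (?V a) n = complex_of_real (?w j m) * (complex_of_real (\<beta> m) * a m)"
        using False by (simp_all add: Mz_def wshift_def m_def)
      moreover have "\<beta> n = ?w j m * \<beta> m"
        by (subst n) (rule step)
      ultimately show ?thesis by simp
    qed (simp add: Mz_def wshift_def)
  qed
  with unitary_map_to_l2[of \<beta>, OF pos]
  show "\<exists>V. unitary_map (H2 \<beta>) (H2_norm \<beta>) l2 l2_norm V \<and> (\<forall>j. \<forall>a\<in>H2 \<beta>. V (Mz j a) = wshift ?w j (V a))"
    by blast
qed

end
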